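(* Let $p\ge7$ be prime. Then the structure $(\mathbb{F}_p[t],+,M)$ is NIP, where $M=\{(t^i,t^j,t^{i+j}):i,j\in\mathbb{N}\}\subseteq\mathbb{F}_p[t]^3$ is a ternary relation.
   Context: $\mathbb{N}$ includes $0$; $\mathbb{F}_p[t]$ is the polynomial ring in one variable over the field with $p$ elements, and $+$ is its addition. *)

theory Defs
  imports "HOL-Computational_Algebra.Computational_Algebra" "HOL-Library.Cardinality"
begin

text \<open>
  First-order logic with equality over the signature with one binary function symbol
  and one ternary relation symbol. Variables are named by natural numbers.
\<close>

datatype tm = Var nat | Plus tm tm

datatype fm = Eq tm tm | Rel tm tm tm | Neg fm | Conj fm fm | Ex nat fm

fun fv_tm :: "tm \<Rightarrow> nat set" where
  "fv_tm (Var x) = {x}"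
| "fv_tm (Plus s t) = fv_tm s \<union> fv_tm t"

fun fv :: "fm \<Rightarrow> nat set" where
  "fv (Eq s t) = fv_tm s \<union> fv_tm t"
| "fv (Rel s t u) = fv_tm s \<union> fv_tm t \<union> fv_tm u"
| "fv (Neg \<phi>) = fv \<phi>"
| "fv (Conj \<phi> \<psi>) = fv \<phi> \<union> fv \<psi>"
| "fv (Ex x \<phi>) = fv \<phi> - {x}"

text \<open>
  A structure is given by the interpretations \<open>f\<close> and \<open>R\<close> of the two symbols; its universe
  is the whole type \<open>'u\<close>.
\<close>

fun val :: "('u \<Rightarrow> 'u \<Rightarrow> 'u) \<Rightarrow> (nat \<Rightarrow> 'u) \<Rightarrow> tm \<Rightarrow> 'u" where
  "val f v (Var x) = v x"
| "val f v (Plus s t) = f (val f v s) (val f v t)"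

fun sat :: "('u \<Rightarrow> 'u \<Rightarrow> 'u) \<Rightarrow> ('u \<times> 'u \<times> 'u) set \<Rightarrow> (nat \<Rightarrow> 'u) \<Rightarrow> fm \<Rightarrow> bool" where
  "sat f R v (Eq s t) \<longleftrightarrow> val f v s = val f v t"
| "sat f R v (Rel s t u) \<longleftrightarrow> (val f v s, val f v t, val f v u) \<in> R"
| "sat f R v (Neg \<phi>) \<longleftrightarrow> \<not> sat f R v \<phi>"
| "sat f R v (Conj \<phi> \<psi>) \<longleftrightarrow> sat f R v \<phi> \<and> sat f R v \<psi>"
| "sat f R v (Ex x \<phi>) \<longleftrightarrow> (\<exists>a. sat f R (v(x := a)) \<phi>)"

text \<open>
  A partitioned formula \<open>\<phi>(x\<^sub>0,\<dots>,x\<^sub>m\<^sub>-\<^sub>1; y\<^sub>0,\<dots>,y\<^sub>n\<^sub>-\<^sub>1)\<close> is a formula whose free variables are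
  among \<open>0,\<dots>,m+n-1\<close>; the first \<open>m\<close> of these are the object variables and the remaining
  \<open>n\<close> the parameter variables. When \<open>fv \<phi> \<subseteq> {..<m + n}\<close>, the entries of \<open>(!)\<close> beyond
  the end of the list do not matter.
\<close>

definition shatters_size ::
    "('u \<Rightarrow> 'u \<Rightarrow> 'u) \<Rightarrow> ('u \<times> 'u \<times> 'u) set \<Rightarrow> fm \<Rightarrow> nat \<Rightarrow> nat \<Rightarrow> nat \<Rightarrow> bool" where
  "shatters_size f R \<phi> m n k \<longleftrightarrow>
     (\<exists>(a :: nat \<Rightarrow> 'u list) (b :: nat set \<Rightarrow> 'u list).
        (\<forall>i<k. length (a i) = m) \<and>
        (\<forall>I\<subseteq>{..<k}. length (b I) = n) \<and>
        (\<forall>i<k. \<forall>I\<subseteq>{..<k}. sat f R ((!) (a i @ b I)) \<phi> \<longleftrightarrow> i \<in> I))"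

definition has_IP ::
    "('u \<Rightarrow> 'u \<Rightarrow> 'u) \<Rightarrow> ('u \<times> 'u \<times> 'u) set \<Rightarrow> fm \<Rightarrow> nat \<Rightarrow> nat \<Rightarrow> bool" where
  "has_IP f R \<phi> m n \<longleftrightarrow> (\<forall>k. shatters_size f R \<phi> m n k)"

text \<open>
  Stated with arbitrarily large finite shattered families in the structure itself, so no
  elementary extension is needed: for each \<open>k\<close>, shattering a family of size \<open>k\<close>
  is a first-order sentence. Every partition of the free variables of a formula has the
  above form up to renaming of variables.
\<close>

definition NIP :: "('u \<Rightarrow> 'u \<Rightarrow> 'u) \<Rightarrow> ('u \<times> 'u \<times> 'u) set \<Rightarrow> bool" where
  "NIP f R \<longleftrightarrow> (\<forall>\<phi> m n. fv \<phi> \<subseteq> {..<m + n} \<longrightarrow> \<not> has_IP f R \<phi> m n)"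

definition mult_powers :: "('a::field poly \<times> 'a poly \<times> 'a poly) set" where
  "mult_powers = {(monom 1 i, monom 1 j, monom 1 (i + j)) | i j. True}"

end

theory Submission
  imports Defs
begin

text \<open>
  The powers of \<open>t\<close> form a basis of the vector space, and multiplication turns this basis into a
  copy of \<open>(\<nat>,+)\<close>. A back-and-forth argument shows that the truth of a formula at a tuple \<open>v\<close> only
  depends on which linear combinations of \<open>v\<close> have at most \<open>N\<close> nonzero coefficients, and on the
  Presburger type (signs of bounded integer linear forms, residues modulo \<open>d\<close>) of the exponents
  occurring in these combinations: a new element is either far from all combinations of \<open>v\<close>, and then
  all such choices look alike, or it is a combination of \<open>v\<close> plus a few powers of \<open>t\<close>, and then
  only Presburger types have to be extended. Over a finite field, the types realised by a varying
  \<open>y\<close> over fixed tuples \<open>a\<^sub>0,\<dots>,a\<^sub>k\<^sub>-\<^sub>1\<close> are then bounded in number by a polynomial in \<open>k\<close>: record which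
  combinations of \<open>y\<close> are close to which combinations of the \<open>a\<^sub>i\<close>, and where the integer linear forms in
  the exponents of the differences lie among polynomially many cut points. So \<open>2\<^sup>k\<close> types are impossible.
\<close>

section \<open>Presburger types of exponents\<close>

text \<open>The projection \<open>\<pi>\<close> is a parameter so that one family of coefficients,
  indexed by the pairs themselves, can be evaluated at the sources (\<open>fst\<close>) and at the
  targets (\<open>snd\<close>).\<close>

definition lf :: "(nat \<times> nat) set \<Rightarrow> (nat \<times> nat \<Rightarrow> nat) \<Rightarrow> (nat \<times> nat \<Rightarrow> int) \<Rightarrow> int \<Rightarrow> int" where
  "lf U \<pi> \<alpha> c = (\<Sum>u\<in>U. \<alpha> u * int (\<pi> u)) + c"

text \<open>
  \<open>U\<close> is the graph of a finite partial map on exponents; for \<open>C \<ge> 1\<close> the sign condition makes it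
  single-valued and injective.
\<close>

definition pres :: "nat \<Rightarrow> nat \<Rightarrow> (nat \<times> nat) set \<Rightarrow> bool" where
  "pres C d U \<longleftrightarrow> finite U \<and>
     (\<forall>\<alpha> c. (\<forall>u\<in>U. \<bar>\<alpha> u\<bar> \<le> int C) \<longrightarrow> \<bar>c\<bar> \<le> int C \<longrightarrow> sgn (lf U fst \<alpha> c) = sgn (lf U snd \<alpha> c)) \<and>
     (\<forall>u\<in>U. int d dvd int (fst u) - int (snd u))"

lemma presD_finite: "pres C d U \<Longrightarrow> finite U"
  by (simp add: pres_def)

lemma presD_sgn:
  "pres C d U \<Longrightarrow> (\<And>u. u \<in> U \<Longrightarrow> \<bar>\<alpha> u\<bar> \<le> int C) \<Longrightarrow> \<bar>c\<bar> \<le> int C \<Longrightarrow>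
    sgn (lf U fst \<alpha> c) = sgn (lf U snd \<alpha> c)"
  by (simp add: pres_def)

lemma presD_dvd: "pres C d U \<Longrightarrow> u \<in> U \<Longrightarrow> int d dvd int (fst u) - int (snd u)"
  by (simp add: pres_def)

lemma pres_mono:
  assumes "pres C d U" "C' \<le> C" "d' dvd d"
  shows "pres C' d' U"
  using assms unfolding pres_def
  by (meson dual_order.trans dvd_trans int_dvd_int_iff of_nat_le_iff)

lemma lf_converse: "lf (U\<inverse>) fst \<alpha> c = lf U snd (\<alpha> \<circ> prod.swap) c"
  "lf (U\<inverse>) snd \<alpha> c = lf U fst (\<alpha> \<circ> prod.swap) c"
proof -
  have U: "U\<inverse> = prod.swap ` U" by auto
  have inj: "inj_on prod.swap U" by (auto simp: inj_on_def)
  show "lf (U\<inverse>) fst \<alpha> c = lf U snd (\<alpha> \<circ> prod.swap) c"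
    "lf (U\<inverse>) snd \<alpha> c = lf U fst (\<alpha> \<circ> prod.swap) c"
    unfolding lf_def U sum.reindex[OF inj] by (auto intro!: sum.cong)
qed

lemma pres_converse:
  assumes "pres C d U"
  shows "pres C d (U\<inverse>)"
  unfolding pres_def
proof (intro conjI allI impI ballI)
  show "finite (U\<inverse>)" using assms by (simp add: pres_def)
next
  fix \<alpha> c assume a: "\<forall>u\<in>U\<inverse>. \<bar>\<alpha> u\<bar> \<le> int C" and c: "\<bar>c\<bar> \<le> int C"
  show "sgn (lf (U\<inverse>) fst \<alpha> c) = sgn (lf (U\<inverse>) snd \<alpha> c)"
    unfolding lf_converse
    by (rule presD_sgn[OF assms, symmetric]) (use a c in auto)
next
  fix u assume "u \<in> U\<inverse>"
  then show "int d dvd int (fst u) - int (snd u)"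
    using presD_dvd[OF assms, of "prod.swap u"] by (auto simp: dvd_diff_commute)
qed

lemma lf_diff: "lf U \<pi> \<alpha> c - lf U \<pi> \<beta> b = lf U \<pi> (\<lambda>u. \<alpha> u - \<beta> u) (c - b)"
  by (simp add: lf_def sum_subtractf left_diff_distrib)

lemma lf_add_const: "lf U \<pi> \<alpha> c + h = lf U \<pi> \<alpha> (c + h)"
  by (simp add: lf_def)

lemma lf_mult: "k * lf U \<pi> \<alpha> c = lf U \<pi> (\<lambda>u. k * \<alpha> u) (k * c)"
  by (simp add: lf_def distrib_left sum_distrib_left mult.assoc)

lemma lf_dvd_diff:
  assumes "\<And>u. u \<in> U \<Longrightarrow> k dvd int (fst u) - int (snd u)"
  shows "k dvd lf U fst \<alpha> c - lf U snd \<alpha> c"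
proof -
  have "lf U fst \<alpha> c - lf U snd \<alpha> c = (\<Sum>u\<in>U. \<alpha> u * (int (fst u) - int (snd u)))"
    by (simp add: lf_def sum_subtractf right_diff_distrib)
  then show ?thesis using assms by (auto intro!: dvd_sum dvd_mult)
qed

lemma sgn_eq_int_iffs:
  fixes a b :: int
  assumes "sgn a = sgn b"
  shows "0 \<le> a \<longleftrightarrow> 0 \<le> b" "0 < a \<longleftrightarrow> 0 < b"
  using assms by (auto simp: sgn_if split: if_splits)

text \<open>
  All constraints on \<open>y\<close> compare \<open>L * y\<close> with linear forms over \<open>U\<close>. If \<open>f\<^sub>1\<close> is the largest form below
  \<open>L * x\<close>, then \<open>L * y\<close> is put at distance \<open>h\<close> above the image of \<open>f\<^sub>1\<close>, where \<open>h\<close> is the distance of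
  \<open>L * x\<close> from \<open>f\<^sub>1\<close>, reduced modulo \<open>L * d'\<close> to a bounded size.
\<close>

lemma pres_extend:
  fixes C' d' x :: nat
  assumes "d' > 0"
  defines "L \<equiv> fact C' :: nat"
  assumes pU: "pres (2 * C' * L + L * d' + C') (L * d') U"
  shows "\<exists>y. pres C' d' (insert (x, y) U)"
proof (cases "x \<in> fst ` U")
  case True
  then obtain y where "(x, y) \<in> U" by force
  then have "insert (x, y) U = U" by auto
  moreover have "pres C' d' U" by (rule pres_mono[OF pU]) auto
  ultimately show ?thesis by metis
next
  case False
  define K where "K = int (C' * L)"
  \<comment> \<open>\<open>2 * C' * L\<close> is for differences of two forms with coefficients up
    to \<open>K\<close>, \<open>L * d'\<close> for the shift \<open>h\<close>, and \<open>C'\<close>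
    for forms in which the new exponent has coefficient 0.\<close>
  define C where "C = 2 * C' * L + L * d' + C'"
  have CK: "int C = 2 * K + int L * int d' + int C'" by (simp add: C_def K_def)
  have Lpos: "L > 0" by (simp add: L_def)
  have K0: "K \<ge> 0" by (simp add: K_def)
  define bd where "bd = (\<lambda>(\<alpha>::nat \<times> nat \<Rightarrow> int, c). (\<forall>u\<in>U. \<bar>\<alpha> u\<bar> \<le> K) \<and> \<bar>c\<bar> \<le> K)"
  \<comment> \<open>Minimising the gap \<open>\<mu>\<close> under \<open>P\<close> selects the
    bounded form of largest value not above \<open>L * x\<close>.\<close>
  define P where "P = (\<lambda>(\<alpha>, c). bd (\<alpha>, c) \<and> lf U fst \<alpha> c \<le> int L * int x)"
  define \<mu> where "\<mu> = (\<lambda>(\<alpha>, c). nat (int L * int x - lf U fst \<alpha> c))"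
  have P0: "P (\<lambda>_. 0, 0)" using K0 by (simp add: P_def bd_def lf_def)
  obtain f where f: "P f" and fmin: "\<And>g. P g \<Longrightarrow> \<mu> f \<le> \<mu> g"
    using ex_has_least_nat[of P _ \<mu>] P0 by metis
  obtain \<alpha>1 c1 where fe: "f = (\<alpha>1, c1)" by force
  define v where "v = lf U fst \<alpha>1 c1"
  define v' where "v' = lf U snd \<alpha>1 c1"
  have b1: "\<And>u. u \<in> U \<Longrightarrow> \<bar>\<alpha>1 u\<bar> \<le> K" "\<bar>c1\<bar> \<le> K" and vx: "v \<le> int L * int x"
    using f unfolding fe P_def bd_def v_def by auto
  have max: "lf U fst \<alpha> c \<le> v" if "bd (\<alpha>, c)" "lf U fst \<alpha> c \<le> int L * int x" for \<alpha> c
    using fmin[of "(\<alpha>, c)"] that vx unfolding fe P_def \<mu>_def v_def by auto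
  have v0: "0 \<le> v" using max[of "\<lambda>_. 0" 0] K0 by (simp add: bd_def lf_def)
  define D where "D = int L * int d'"
  have D0: "D > 0" using Lpos assms(1) by (simp add: D_def)
  define g where "g = int L * int x - v"
  have g0: "g \<ge> 0" using vx by (simp add: g_def)
  obtain h where h: "0 \<le> h" "h \<le> D" "D dvd g - h" "h = g \<or> 1 \<le> h \<and> h < g"
  proof (cases "g \<le> D")
    case True then show ?thesis using that[of g] g0 by auto
  next
    case False
    \<comment> \<open>Residues are taken in \<open>1..D\<close> and not in \<open>0..D-1\<close>:
      the new point has to stay strictly above the image of the chosen form.\<close>
    have "(g - 1) mod D < D" "(g - 1) mod D \<ge> 0" using D0 by auto
    moreover have "D dvd g - ((g - 1) mod D + 1)"
    proof -
      have "g - ((g - 1) mod D + 1) = (g - 1) - (g - 1) mod D" by simp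
      then show ?thesis by (metis dvd_minus_mod)
    qed
    ultimately show ?thesis using that[of "(g - 1) mod D + 1"] False by auto
  qed
  have Dv: "D dvd v - v'" unfolding v_def v'_def
    by (rule lf_dvd_diff) (use presD_dvd[OF pU] in \<open>auto simp: D_def\<close>)
  have "(v' + h) - int L * int x = - (v - v') - (g - h)" by (simp add: g_def)
  \<comment> \<open>As \<open>D = L * d'\<close>, this makes \<open>v' + h\<close> a multiple of
    \<open>L\<close>, so that \<open>y\<close> can be defined, and makes \<open>y\<close> congruent
    to \<open>x\<close> modulo \<open>d'\<close>.\<close>
  then have Dd: "D dvd (v' + h) - int L * int x" using Dv h(3) by (metis dvd_diff dvd_minus_iff)
  from Dd obtain j where "(v' + h) - int L * int x = D * j" by (rule dvdE)
  then have j: "v' + h = int L * int x + D * j" by simp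
  have sg: "sgn (lf U fst \<alpha> c) = sgn (lf U snd \<alpha> c)"
    if "\<And>u. u \<in> U \<Longrightarrow> \<bar>\<alpha> u\<bar> \<le> int C" "\<bar>c\<bar> \<le> int C" for \<alpha> c
    using presD_sgn[OF pU] that by (simp add: C_def)
  have DC: "int C = 2 * K + D + int C'" by (simp add: CK D_def)
  have "sgn (v + h) = sgn (v' + h)"
    unfolding v_def v'_def lf_add_const
  proof (rule sg)
    show "\<bar>\<alpha>1 u\<bar> \<le> int C" if "u \<in> U" for u using b1(1)[OF that] K0 D0 by (simp add: DC)
    show "\<bar>c1 + h\<bar> \<le> int C" using b1(2) K0 h(1,2) by (simp add: DC)
  qed
  then have v'h: "v' + h \<ge> 0" using v0 h(1) sgn_eq_int_iffs(1)[of "v + h" "v' + h"] by simp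
  have "int L * (int x + int d' * j) \<ge> 0" using v'h j by (simp add: D_def algebra_simps)
  then have y0: "int x + int d' * j \<ge> 0" using Lpos by (simp add: zero_le_mult_iff)
  define y where "y = nat (int x + int d' * j)"
  have y: "int y = int x + int d' * j" using y0 by (simp add: y_def)
  have Ly: "int L * int y = v' + h" unfolding y j D_def by (simp add: algebra_simps)
  have Lx: "int L * int x = v + g" by (simp add: g_def)
  \<comment> \<open>If \<open>h = g\<close>, the differences are themselves bounded forms over
    \<open>U\<close>. If \<open>h < g\<close>, no bounded form has a value above \<open>v\<close>
    and up to \<open>L * x\<close>, so each one is at most \<open>v\<close> or exceeds
    \<open>v + h\<close>, and either relation passes to the targets.\<close>
  have key: "sgn (int L * int x - lf U fst \<alpha> c) = sgn (int L * int y - lf U snd \<alpha> c)"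
    if b: "bd (\<alpha>, c)" for \<alpha> c
    using h(4)
  proof
    assume hg: "h = g"
    have "v + h - lf U fst \<alpha> c = lf U fst (\<lambda>u. \<alpha>1 u - \<alpha> u) (c1 + h - c)"
      "v' + h - lf U snd \<alpha> c = lf U snd (\<lambda>u. \<alpha>1 u - \<alpha> u) (c1 + h - c)"
      by (simp_all add: v_def v'_def lf_add_const lf_diff)
    moreover have "sgn (lf U fst (\<lambda>u. \<alpha>1 u - \<alpha> u) (c1 + h - c)) = sgn (lf U snd (\<lambda>u. \<alpha>1 u - \<alpha> u) (c1 + h - c))"
    proof (rule sg)
      fix u assume "u \<in> U"
      then have "\<bar>\<alpha>1 u\<bar> \<le> K" "\<bar>\<alpha> u\<bar> \<le> K" using b1 b by (auto simp: bd_def)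
      then show "\<bar>\<alpha>1 u - \<alpha> u\<bar> \<le> int C" using D0 by (simp add: DC)
    next
      have "\<bar>c\<bar> \<le> K" using b by (auto simp: bd_def)
      then show "\<bar>c1 + h - c\<bar> \<le> int C" using b1(2) h(1,2) by (simp add: DC)
    qed
    ultimately show ?thesis using hg by (simp add: Lx Ly)
  next
    assume hl: "1 \<le> h \<and> h < g"
    show ?thesis
    proof (cases "lf U fst \<alpha> c \<le> int L * int x")
      case True
      then have le: "lf U fst \<alpha> c \<le> v" using max b by auto
      have "sgn (lf U fst (\<lambda>u. \<alpha>1 u - \<alpha> u) (c1 - c)) = sgn (lf U snd (\<lambda>u. \<alpha>1 u - \<alpha> u) (c1 - c))"
      proof (rule sg)
        fix u assume "u \<in> U"
        then have "\<bar>\<alpha>1 u\<bar> \<le> K" "\<bar>\<alpha> u\<bar> \<le> K" using b1 b by (auto simp: bd_def)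
        then show "\<bar>\<alpha>1 u - \<alpha> u\<bar> \<le> int C" using D0 by (simp add: DC)
      next
        have "\<bar>c\<bar> \<le> K" using b by (auto simp: bd_def)
        then show "\<bar>c1 - c\<bar> \<le> int C" using b1(2) D0 by (simp add: DC)
      qed
      then have "sgn (v - lf U fst \<alpha> c) = sgn (v' - lf U snd \<alpha> c)" by (simp add: v_def v'_def lf_diff)
      then have "lf U snd \<alpha> c \<le> v'" using le sgn_eq_int_iffs(1) by (metis diff_ge_0_iff_ge)
      then show ?thesis using hl le by (simp add: Lx Ly)
    next
      case False
      have "sgn (lf U fst (\<lambda>u. \<alpha> u - \<alpha>1 u) (c - (c1 + h))) = sgn (lf U snd (\<lambda>u. \<alpha> u - \<alpha>1 u) (c - (c1 + h)))"
      proof (rule sg)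
        fix u assume "u \<in> U"
        then have "\<bar>\<alpha>1 u\<bar> \<le> K" "\<bar>\<alpha> u\<bar> \<le> K" using b1 b by (auto simp: bd_def)
        then show "\<bar>\<alpha> u - \<alpha>1 u\<bar> \<le> int C" using D0 by (simp add: DC)
      next
        have "\<bar>c\<bar> \<le> K" using b by (auto simp: bd_def)
        then show "\<bar>c - (c1 + h)\<bar> \<le> int C" using b1(2) h(1,2) by (simp add: DC)
      qed
      then have "sgn (lf U fst \<alpha> c - (v + h)) = sgn (lf U snd \<alpha> c - (v' + h))"
        by (simp add: v_def v'_def lf_add_const lf_diff)
      moreover have "lf U fst \<alpha> c - (v + h) > 0" using False hl by (simp add: Lx)
      ultimately have "lf U snd \<alpha> c > v' + h" using sgn_eq_int_iffs(2) by (metis diff_gt_0_iff_gt)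
      then show ?thesis using False by (simp add: Ly)
    qed
  qed
  have "pres C' d' (insert (x, y) U)"
    unfolding pres_def
  proof (intro conjI allI impI ballI)
    show "finite (insert (x, y) U)" using presD_finite[OF pU] by simp
  next
    fix u assume u: "u \<in> insert (x, y) U"
    show "int d' dvd int (fst u) - int (snd u)"
    proof (cases "u = (x, y)")
      case True then show ?thesis by (simp add: y)
    next
      case False
      then show ?thesis using presD_dvd[OF pU, of u] u by (auto intro: dvd_mult_right)
    qed
  next
    fix \<alpha> c
    assume a: "\<forall>u\<in>insert (x, y) U. \<bar>\<alpha> u\<bar> \<le> int C'" and c: "\<bar>c\<bar> \<le> int C'"
    define \<beta> where "\<beta> = \<alpha> (x, y)"
    have \<beta>: "\<bar>\<beta>\<bar> \<le> int C'" using a by (simp add: \<beta>_def)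
    have ni: "(x, y) \<notin> U" using False by force
    have ins: "lf (insert (x, y) U) fst \<alpha> c = \<beta> * int x + lf U fst \<alpha> c"
      "lf (insert (x, y) U) snd \<alpha> c = \<beta> * int y + lf U snd \<alpha> c"
      using ni presD_finite[OF pU] by (simp_all add: lf_def \<beta>_def)
    show "sgn (lf (insert (x, y) U) fst \<alpha> c) = sgn (lf (insert (x, y) U) snd \<alpha> c)"
    proof (cases "\<beta> = 0")
      case True
      show ?thesis
      proof -
        have "\<bar>\<alpha> u\<bar> \<le> int C" if "u \<in> U" for u
        proof -
          have "\<bar>\<alpha> u\<bar> \<le> int C'" using a that by simp
          then show ?thesis using K0 D0 by (simp add: DC)
        qed
        moreover have "\<bar>c\<bar> \<le> int C" using c K0 D0 by (simp add: DC)
        ultimately show ?thesis using sg[of \<alpha> c] by (simp add: ins True)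
      qed
    next
      case False
      \<comment> \<open>The factorial is a multiple of every nonzero coefficient that the new
        exponent can have, so multiplication by \<open>M\<close> turns \<open>\<beta> * x\<close>
        into \<open>L * x\<close>.\<close>
      have "nat \<bar>\<beta>\<bar> dvd L" unfolding L_def using \<beta> False by (intro dvd_fact) auto
      then have "\<bar>\<beta>\<bar> dvd int L" by (metis abs_ge_zero int_dvd_int_iff int_nat_eq)
      then obtain M where M: "int L = \<beta> * M" by auto
      have M0: "M \<noteq> 0" using M Lpos by auto
      have Mle: "\<bar>M\<bar> \<le> int L"
        using M Lpos False by (metis abs_of_nat dvd_imp_le_int dvd_triv_right of_nat_0_less_iff less_irrefl)
      have bM: "bd (\<lambda>u. (- M) * \<alpha> u, (- M) * c)"
      proof -
        have "\<bar>M\<bar> * \<bar>r\<bar> \<le> K" if "\<bar>r\<bar> \<le> int C'" for r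
          using mult_mono[OF Mle that] by (simp add: K_def mult.commute)
        then show ?thesis using a c by (auto simp: bd_def abs_mult)
      qed
      have "sgn M * sgn (\<beta> * int x + lf U fst \<alpha> c) = sgn (M * (\<beta> * int x + lf U fst \<alpha> c))"
        by (simp add: sgn_mult)
      also have "M * (\<beta> * int x + lf U fst \<alpha> c) = int L * int x - (- M) * lf U fst \<alpha> c"
        by (simp add: M algebra_simps)
      also have "sgn \<dots> = sgn (int L * int y - (- M) * lf U snd \<alpha> c)"
        unfolding lf_mult by (rule key[OF bM])
      also have "int L * int y - (- M) * lf U snd \<alpha> c = M * (\<beta> * int y + lf U snd \<alpha> c)"
        by (simp add: M algebra_simps)
      also have "sgn \<dots> = sgn M * sgn (\<beta> * int y + lf U snd \<alpha> c)"
        by (simp add: sgn_mult)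
      finally show ?thesis unfolding ins using M0 by (simp add: sgn_0_0)
    qed
  qed
  then show ?thesis ..
qed

text \<open>One exponent at a time, with the bounds computed backwards: the last extension, which
  ends at \<open>C\<close> and \<open>d\<close>, fixes what the first \<open>k\<close> have to
  deliver. \<open>C \<le> C'\<close> and \<open>d dvd d'\<close> are recorded so that a map that is
  not extended also satisfies the final bounds.\<close>

lemma pres_extend_finite:
  "d > 0 \<Longrightarrow> \<exists>C' d'. d' > 0 \<and> C \<le> C' \<and> d dvd d' \<and> (\<forall>U A. pres C' d' U \<longrightarrow> finite A \<longrightarrow> card A \<le> k \<longrightarrow>
      (\<exists>U'. U \<subseteq> U' \<and> pres C d U' \<and> A \<subseteq> fst ` U'))"
proof (induction k arbitrary: C d)
  case 0
  have "\<forall>U A. pres C d U \<longrightarrow> finite A \<longrightarrow> card A \<le> 0 \<longrightarrow> (\<exists>U'. U \<subseteq> U' \<and> pres C d U' \<and> A \<subseteq> fst ` U')"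
    by auto
  then show ?case using 0 by - (rule exI[of _ C], rule exI[of _ d], simp)
next
  case (Suc k)
  define C1 where "C1 = 2 * C * fact C + fact C * d + C"
  define d1 where "d1 = fact C * d"
  have "d1 > 0" using Suc.prems by (simp add: d1_def)
  from Suc.IH[OF this, of C1] obtain C' d' where d': "d' > 0" and CC: "C1 \<le> C'" "d1 dvd d'" and IH: "\<And>U A. pres C' d' U \<Longrightarrow> finite A \<Longrightarrow> card A \<le> k \<Longrightarrow>
      (\<exists>U'. U \<subseteq> U' \<and> pres C1 d1 U' \<and> A \<subseteq> fst ` U')" by blast
  have "\<exists>U'. U \<subseteq> U' \<and> pres C d U' \<and> A \<subseteq> fst ` U'"
    if U: "pres C' d' U" and A: "finite A" "card A \<le> Suc k" for U A
  proof -
    obtain x B where B: "A \<subseteq> insert x B" "finite B" "card B \<le> k"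
    proof (cases "A = {}")
      case True then show ?thesis using that[of 0 "{}"] by simp
    next
      case False
      then obtain x where "x \<in> A" by auto
      then show ?thesis using that[of x "A - {x}"] A by (simp add: card_Diff_singleton subset_insertI)
    qed
    obtain U1 where U1: "U \<subseteq> U1" "pres C1 d1 U1" "B \<subseteq> fst ` U1" using IH[OF U B(2,3)] by blast
    obtain y where "pres C d (insert (x, y) U1)"
      using pres_extend[OF Suc.prems, of C U1 x] U1(2) unfolding C1_def d1_def by blast
    then show ?thesis using U1 B(1) by (intro exI[of _ "insert (x, y) U1"]) auto
  qed
  moreover have "C \<le> C'" "d dvd d'" using CC by (auto simp: C1_def d1_def)
  ultimately show ?case using d' by blast
qed

section \<open>Back-and-forth\<close>

definition supp :: "'a::zero poly \<Rightarrow> nat set" where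
  "supp z = {i. coeff z i \<noteq> 0}"

abbreviation wt :: "'a::zero poly \<Rightarrow> nat" where
  "wt z \<equiv> card (supp z)"

lemma finite_supp: "finite (supp z)"
  by (rule finite_subset[of _ "{..degree z}"]) (auto simp: supp_def le_degree)

lemma wt_0: "wt 0 = 0"
  by (simp add: supp_def)

lemma wt_add_le: "wt (x + y) \<le> wt x + wt y"
proof -
  have "wt (x + y) \<le> card (supp x \<union> supp y)"
    by (rule card_mono) (auto simp: finite_supp, auto simp: supp_def)
  then show ?thesis using card_Un_le le_trans by blast
qed

lemma wt_smult: "c \<noteq> 0 \<Longrightarrow> wt (smult c z) = wt z" for c :: "'a::field"
  by (simp add: supp_def)

lemma wt_smult_le: "wt (smult c z) \<le> wt z" for c :: "'a::field"
  by (cases "c = 0") (auto simp: wt_smult wt_0)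

lemma wt_diff_le: "wt (x - y) \<le> wt x + wt (y :: 'a::field poly)"
  using wt_add_le[of x "smult (-1) y"] wt_smult[of "-1" y] by simp

lemma wt_monom_le: "wt (monom c i) \<le> 1"
proof -
  have "wt (monom c i) \<le> card {i}" by (rule card_mono) (auto simp: supp_def)
  then show ?thesis by simp
qed

lemma wt_sum_monom_le: "finite A \<Longrightarrow> wt (\<Sum>i\<in>A. monom (f i) (g i)) \<le> card A"
proof (induction A rule: finite_induct)
  case empty then show ?case by (simp add: wt_0)
next
  case (insert x A)
  then show ?case
    using wt_add_le[of "monom (f x) (g x)" "\<Sum>i\<in>A. monom (f i) (g i)"] wt_monom_le[of "f x" "g x"]
    by simp
qed

lemma sum_monom_supp: "(\<Sum>i\<in>supp z. monom (coeff z i) i) = z"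
  by (rule poly_eqI) (use finite_supp[of z] in \<open>auto simp: coeff_sum sum.delta' supp_def\<close>)

text \<open>The linear map \<open>t\<^sup>a \<mapsto> t\<^sup>b\<close>, \<open>(a, b) \<in> U\<close>, as a linear relation; no single-valuedness is assumed.\<close>

definition transl :: "(nat \<times> nat) set \<Rightarrow> ('a::field poly \<times> 'a poly) set" where
  "transl U = {(\<Sum>u\<in>U. monom (c u) (fst u), \<Sum>u\<in>U. monom (c u) (snd u)) | c. True}"

lemma translI: "z = (\<Sum>u\<in>U. monom (c u) (fst u)) \<Longrightarrow> z' = (\<Sum>u\<in>U. monom (c u) (snd u)) \<Longrightarrow> (z, z') \<in> transl U"
  by (auto simp: transl_def)

lemma translE:
  assumes "(z, z') \<in> transl U"
  obtains c where "z = (\<Sum>u\<in>U. monom (c u) (fst u))" "z' = (\<Sum>u\<in>U. monom (c u) (snd u))"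
  using assms by (auto simp: transl_def)

lemma smult_sum_right: "smult k (\<Sum>x\<in>A. f x) = (\<Sum>x\<in>A. smult k (f x))"
  by (induction A rule: infinite_finite_induct) (auto simp: smult_add_right)

lemma transl_0: "(0, 0) \<in> transl U"
  by (rule translI[where c = "\<lambda>_. 0"]) auto

lemma transl_add:
  assumes "(x, x') \<in> transl U" "(y, y') \<in> transl U"
  shows "(x + y, x' + y') \<in> transl U"
proof -
  obtain c d where "x = (\<Sum>u\<in>U. monom (c u) (fst u))" "x' = (\<Sum>u\<in>U. monom (c u) (snd u))"
    "y = (\<Sum>u\<in>U. monom (d u) (fst u))" "y' = (\<Sum>u\<in>U. monom (d u) (snd u))"
    using assms by (auto elim!: translE)
  then show ?thesis
    by (intro translI[where c = "\<lambda>u. c u + d u"]) (simp_all add: sum.distrib flip: add_monom)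
qed

lemma transl_smult:
  assumes "(x, x') \<in> transl U"
  shows "(smult k x, smult k x') \<in> transl U"
proof -
  obtain c where "x = (\<Sum>u\<in>U. monom (c u) (fst u))" "x' = (\<Sum>u\<in>U. monom (c u) (snd u))"
    using assms by (auto elim!: translE)
  then show ?thesis
    by (intro translI[where c = "\<lambda>u. k * c u"]) (simp_all add: smult_sum_right smult_monom)
qed

lemma transl_mono:
  assumes "(x, x') \<in> transl U" "U \<subseteq> U'" "finite U'"
  shows "(x, x') \<in> transl U'"
proof -
  obtain c where c: "x = (\<Sum>u\<in>U. monom (c u) (fst u))" "x' = (\<Sum>u\<in>U. monom (c u) (snd u))"
    using assms by (auto elim!: translE)
  show ?thesis
    by (rule translI[where c = "\<lambda>u. if u \<in> U then c u else 0"]; unfold c)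
      (rule sum.mono_neutral_cong_left; use assms in auto)+
qed

lemma transl_converse: "(x, x') \<in> transl (U\<inverse>) \<longleftrightarrow> (x', x) \<in> transl U"
proof -
  have *: "(x', x) \<in> transl U" if h: "(x, x') \<in> transl (U\<inverse>)" for x x' :: "'a poly" and U
  proof -
    have U: "U\<inverse> = prod.swap ` U" by auto
    have inj: "inj_on prod.swap U" by (auto simp: inj_on_def)
    obtain c where "x = (\<Sum>u\<in>U\<inverse>. monom (c u) (fst u))" "x' = (\<Sum>u\<in>U\<inverse>. monom (c u) (snd u))"
      using h by (rule translE)
    then show ?thesis
      by (intro translI[where c = "c \<circ> prod.swap"]) (simp_all add: U sum.reindex[OF inj])
  qed
  show ?thesis using *[of x x' U] *[of x' x "U\<inverse>"] by auto
qed

text \<open>Distinct indices may share a pair of \<open>U\<close>; adding one summand at a time lets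
  their coefficients accumulate.\<close>

lemma transl_sum_monom:
  assumes "finite U" "\<And>i. i \<in> A \<Longrightarrow> (g i, g' i) \<in> U"
  shows "(\<Sum>i\<in>A. monom (c i) (g i), \<Sum>i\<in>A. monom (c i) (g' i)) \<in> transl U"
  using assms(2)
proof (induction A rule: infinite_finite_induct)
  case (insert i A)
  have "(monom (c i) (g i), monom (c i) (g' i)) \<in> transl {(g i, g' i)}"
    by (rule translI[where c = "\<lambda>_. c i"]) auto
  then have "(monom (c i) (g i), monom (c i) (g' i)) \<in> transl U"
    by (rule transl_mono) (use insert assms in auto)
  then show ?case using insert by (auto intro!: transl_add)
qed (auto simp: transl_0)

text \<open>Every exponent of \<open>z\<close> moves to some partner in \<open>U\<close>. If
  partners collide, terms merge and the weight only drops.\<close>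

lemma transl_obtain:
  assumes "finite U" "supp z \<subseteq> fst ` U"
  obtains z' where "(z, z') \<in> transl U" "wt z' \<le> wt z"
proof -
  have "\<forall>i\<in>supp z. \<exists>j. (i, j) \<in> U" using assms(2) by force
  then obtain f where f: "\<And>i. i \<in> supp z \<Longrightarrow> (i, f i) \<in> U" by metis
  show ?thesis
    using transl_sum_monom[OF assms(1), of "supp z" "\<lambda>i. i" f "coeff z"] f
      wt_sum_monom_le[OF finite_supp, of "coeff z" f z] that by (simp add: sum_monom_supp)
qed

section \<open>Linear combinations of a tuple and the back-and-forth relation\<close>

definition lc :: "nat set \<Rightarrow> (nat \<Rightarrow> 'a::field) \<Rightarrow> (nat \<Rightarrow> 'a poly) \<Rightarrow> 'a poly" where
  "lc X c v = (\<Sum>x\<in>X. smult (c x) (v x))"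

lemma lc_add: "lc X c v + lc X d v = lc X (\<lambda>x. c x + d x) v"
  by (simp add: lc_def sum.distrib smult_add_left)

lemma lc_diff: "lc X c v - lc X d v = lc X (\<lambda>x. c x - d x) v"
  by (simp add: lc_def sum_subtractf smult_diff_left)

lemma lc_smult: "smult k (lc X c v) = lc X (\<lambda>x. k * c x) v"
  by (simp add: lc_def smult_sum_right)

text \<open>This covers the case \<open>x \<in> X\<close>, which arises when a quantifier rebinds a
  variable: setting its coefficient to 0 removes the overwritten value \<open>v x\<close>.\<close>

lemma lc_insert_upd:
  assumes "finite X"
  shows "lc (insert x X) c (v(x := a)) = lc X (c(x := 0)) v + smult (c x) a"
proof -
  have "lc (insert x X) c (v(x := a)) = smult (c x) a + (\<Sum>y\<in>X - {x}. smult (c y) (v y))"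
    unfolding lc_def using assms by (subst sum.insert_remove) (auto intro!: sum.cong)
  also have "(\<Sum>y\<in>X - {x}. smult (c y) (v y)) = lc X (c(x := 0)) v"
    unfolding lc_def by (rule sum.mono_neutral_cong_left) (use assms in auto)
  finally show ?thesis by (simp only: add.commute)
qed

lemma lc_delta: "finite X \<Longrightarrow> x \<in> X \<Longrightarrow> lc X (\<lambda>y. if y = x then 1 else 0) v = v x"
  unfolding lc_def by (simp add: if_distrib[of "\<lambda>c. smult c _"] cong: if_cong)

text \<open>A single \<open>U\<close> has to serve all combinations at once. The disjunction of the
  two weight conditions makes the relation symmetric, so that proving "forth" is enough.\<close>

definition bf_equiv :: "nat \<Rightarrow> nat \<Rightarrow> nat \<Rightarrow> nat set \<Rightarrow> (nat \<Rightarrow> 'a::field poly) \<Rightarrow> (nat \<Rightarrow> 'a poly) \<Rightarrow> bool" where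
  "bf_equiv N C d X v w \<longleftrightarrow> (\<exists>U. pres C d U \<and>
     (\<forall>c. wt (lc X c v) \<le> N \<or> wt (lc X c w) \<le> N \<longrightarrow> (lc X c v, lc X c w) \<in> transl U))"

lemma bf_equiv_sym:
  assumes "bf_equiv N C d X v w"
  shows "bf_equiv N C d X w v"
proof -
  obtain U where "pres C d U" "\<forall>c. wt (lc X c v) \<le> N \<or> wt (lc X c w) \<le> N \<longrightarrow> (lc X c v, lc X c w) \<in> transl U"
    using assms by (auto simp: bf_equiv_def)
  then show ?thesis unfolding bf_equiv_def
    by (intro exI[of _ "U\<inverse>"]) (auto simp: pres_converse transl_converse)
qed

lemma bf_equiv_mono:
  assumes "bf_equiv N C d X v w" "N' \<le> N" "C' \<le> C" "d' dvd d"
  shows "bf_equiv N' C' d' X v w"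
  using assms pres_mono[of C d _ C' d'] unfolding bf_equiv_def by (meson le_trans)

text \<open>A sum of \<open>N + 1\<close> consecutive powers of \<open>t\<close> above all degrees
  of the tuple works: no combination cancels any of its terms.\<close>

lemma exists_generic:
  fixes w :: "nat \<Rightarrow> 'a::field poly"
  assumes "finite X"
  shows "\<exists>b. \<forall>c. wt (lc X c w + b) > N"
proof -
  obtain D where D: "\<And>x. x \<in> X \<Longrightarrow> degree (w x) < D"
    using finite_nat_bounded[of "(\<lambda>x. degree (w x)) ` X"] assms by auto
  define b where "b = (\<Sum>j\<in>{D..D+N}. monom (1::'a) j)"
  have "{D..D+N} \<subseteq> supp (lc X c w + b)" for c
    by (auto simp: supp_def lc_def b_def coeff_sum coeff_eq_0 less_le_trans[OF D])
  then have "card {D..D+N} \<le> wt (lc X c w + b)" for c by (intro card_mono finite_supp)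
  then show ?thesis by (intro exI[of _ b]) (simp add: Suc_le_eq)
qed

text \<open>The radius doubles because two combinations within \<open>N\<close> of the same element
  differ by weight at most \<open>2 * N\<close>. At most \<open>N\<close> new exponents are needed,
  those of one sparse remainder.\<close>

lemma bf_equiv_forth:
  assumes "d > 0"
  shows "\<exists>C' d'. d' > 0 \<and> (\<forall>X (v :: nat \<Rightarrow> 'a::field poly) w x a. finite X \<longrightarrow> bf_equiv (2 * N) C' d' X v w \<longrightarrow>
      (\<exists>b. bf_equiv N C d (insert x X) (v(x := a)) (w(x := b))))"
proof -
  obtain C' d' where d': "d' > 0" and CC: "C \<le> C'" "d dvd d'"
    and ext: "\<And>U A. pres C' d' U \<Longrightarrow> finite A \<Longrightarrow> card A \<le> N \<Longrightarrow>
      (\<exists>U'. U \<subseteq> U' \<and> pres C d U' \<and> A \<subseteq> fst ` U')"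
    using pres_extend_finite[OF assms, of C N] by blast
  have "\<exists>b. bf_equiv N C d (insert x X) (v(x := a)) (w(x := b))"
    if X: "finite X" and vw: "bf_equiv (2 * N) C' d' X v w" for X x a and v w :: "nat \<Rightarrow> 'a poly"
  proof -
    obtain U where U: "pres C' d' U"
      and tr: "\<And>c. wt (lc X c v) \<le> 2 * N \<or> wt (lc X c w) \<le> 2 * N \<Longrightarrow> (lc X c v, lc X c w) \<in> transl U"
      using vw by (auto simp: bf_equiv_def)
    show ?thesis
    proof (cases "\<exists>c. wt (lc X c v + a) \<le> N")
      case False
      obtain b where b: "\<And>c. wt (lc X c w + b) > N" using exists_generic[OF X] by metis
      \<comment> \<open>Division by the nonzero coefficient \<open>c x\<close> keeps the weight and
        reduces to a combination plus \<open>e\<close> itself.\<close>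
      have big: "\<not> wt (lc (insert x X) c (u(x := e))) \<le> N"
        if e: "\<And>c. \<not> wt (lc X c u + e) \<le> N" and "c x \<noteq> 0" for c e and u :: "nat \<Rightarrow> 'a poly"
      proof -
        have "lc X (c(x := 0)) u + smult (c x) e = smult (c x) (lc X (\<lambda>y. inverse (c x) * (c(x := 0)) y) u + e)"
          using that(2) by (simp add: smult_add_right lc_smult fun_upd_def if_distrib cong: if_cong flip: mult.assoc)
        then show ?thesis using that by (simp add: lc_insert_upd[OF X] wt_smult)
      qed
      have "bf_equiv N C d (insert x X) (v(x := a)) (w(x := b))"
        unfolding bf_equiv_def
      proof (intro exI conjI allI impI)
        show "pres C d U" using pres_mono[OF U CC] .
        fix c assume *: "wt (lc (insert x X) c (v(x := a))) \<le> N \<or> wt (lc (insert x X) c (w(x := b))) \<le> N"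
        have "c x = 0" using big[of v a c] big[of w b c] * False b not_le by blast
        then show "(lc (insert x X) c (v(x := a)), lc (insert x X) c (w(x := b))) \<in> transl U"
          using tr[of "c(x := 0)"] * by (auto simp: lc_insert_upd[OF X])
      qed
      then show ?thesis ..
    next
      case True
      then obtain c0 where c0: "wt (lc X c0 v + a) \<le> N" by auto
      \<comment> \<open>One near combination \<open>c0\<close> is fixed. The remainder
        \<open>z\<close> is translated to \<open>z'\<close>, and \<open>b\<close> is the element
        with remainder \<open>z'\<close> over the same combination of \<open>w\<close>.\<close>
      define z where "z = lc X c0 v + a"
      obtain U' where U': "U \<subseteq> U'" "pres C d U'" "supp z \<subseteq> fst ` U'"
        using ext[OF U finite_supp] c0 unfolding z_def by blast
      have fU': "finite U'" using U'(2) by (rule presD_finite)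
      obtain z' where z': "(z, z') \<in> transl U'" "wt z' \<le> wt z"
        using transl_obtain[OF fU' U'(3)] by metis
      have zN: "wt z \<le> N" "wt z' \<le> N" using c0 z'(2) by (auto simp: z_def)
      define b where "b = z' - lc X c0 w"
      have "bf_equiv N C d (insert x X) (v(x := a)) (w(x := b))"
        unfolding bf_equiv_def
      proof (intro exI conjI allI impI)
        show "pres C d U'" by fact
        fix c assume *: "wt (lc (insert x X) c (v(x := a))) \<le> N \<or> wt (lc (insert x X) c (w(x := b))) \<le> N"
        define c1 where "c1 = (\<lambda>y. (c(x := 0)) y - c x * c0 y)"
        have shift: "lc (insert x X) c (u(x := e - lc X c0 u)) = lc X c1 u + smult (c x) e" for u e
          unfolding lc_insert_upd[OF X] c1_def by (simp add: smult_diff_right fun_upd_def flip: lc_diff lc_smult)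
        have eqs: "lc (insert x X) c (v(x := a)) = lc X c1 v + smult (c x) z"
          "lc (insert x X) c (w(x := b)) = lc X c1 w + smult (c x) z'"
          using shift[of v z] shift[of w z'] by (simp_all add: z_def b_def)
        have small: "wt (lc X c1 u) \<le> 2 * N" if "wt (lc X c1 u + smult (c x) e) \<le> N" "wt e \<le> N" for u e
          using wt_diff_le[of "lc X c1 u + smult (c x) e" "smult (c x) e"] wt_smult_le[of "c x" e] that by simp
        have "(lc X c1 v, lc X c1 w) \<in> transl U"
          using tr small zN * unfolding eqs by blast
        then show "(lc (insert x X) c (v(x := a)), lc (insert x X) c (w(x := b))) \<in> transl U'"
          unfolding eqs using transl_mono[OF _ U'(1) fU'] z'(1) by (intro transl_add transl_smult) auto
      qed
      then show ?thesis ..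
    qed
  qed
  then show ?thesis using d' by blast
qed

section \<open>Transfer of formulas along the back-and-forth relation\<close>

lemma val_lc: "\<exists>c. \<forall>v :: nat \<Rightarrow> 'a::field poly. \<forall>X. finite X \<longrightarrow> fv_tm s \<subseteq> X \<longrightarrow> val (+) v s = lc X c v"
proof (induction s)
  case (Var x)
  \<comment> \<open>All other variables get coefficient 0, so one \<open>c\<close> serves every
    finite \<open>X\<close> containing the variables of the term.\<close>
  show ?case by (rule exI[of _ "\<lambda>y. if y = x then 1 else 0"]) (auto simp: lc_delta)
next
  case (Plus s t)
  then obtain c d where "\<forall>v :: nat \<Rightarrow> 'a poly. \<forall>X. finite X \<longrightarrow> fv_tm s \<subseteq> X \<longrightarrow> val (+) v s = lc X c v"
    "\<forall>v :: nat \<Rightarrow> 'a poly. \<forall>X. finite X \<longrightarrow> fv_tm t \<subseteq> X \<longrightarrow> val (+) v t = lc X d v" by metis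
  then show ?case by (intro exI[of _ "\<lambda>y. c y + d y"]) (simp add: lc_add)
qed

text \<open>The form with value \<open>i - i = 0\<close> at the sources has value
  \<open>j - j'\<close> at the targets, which must also have sign 0.\<close>

lemma pres_functional:
  assumes "pres C d U" "1 \<le> C" "(i, j) \<in> U" "(i, j') \<in> U"
  shows "j = j'"
proof (rule ccontr)
  assume ne: "j \<noteq> j'"
  define \<alpha> :: "nat \<times> nat \<Rightarrow> int" where "\<alpha> = (\<lambda>u. (if u = (i, j) then 1 else 0) - (if u = (i, j') then 1 else 0))"
  have v: "lf U \<pi> \<alpha> 0 = int (\<pi> (i, j)) - int (\<pi> (i, j'))" for \<pi>
    using presD_finite[OF assms(1)] assms(3,4)
    by (simp add: lf_def \<alpha>_def left_diff_distrib sum_subtractf if_distrib[of "\<lambda>x. x * _"] cong: if_cong)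
  have "sgn (lf U fst \<alpha> 0) = sgn (lf U snd \<alpha> 0)"
    by (rule presD_sgn[OF assms(1)]) (use assms(2) in \<open>auto simp: \<alpha>_def\<close>)
  then show False using ne by (simp add: v sgn_0_0)
qed

text \<open>The sign condition is applied to the form with value \<open>i + j - (i + j) = 0\<close>
  at the sources. The three pairs may coincide, so their indicators add up; 3 bounds the resulting
  coefficients.\<close>

lemma pres_add:
  assumes "pres C d U" "3 \<le> C" "(i, i') \<in> U" "(j, j') \<in> U" "(i + j, k') \<in> U"
  shows "k' = i' + j'"
proof -
  define \<alpha> :: "nat \<times> nat \<Rightarrow> int" where "\<alpha> = (\<lambda>u. (if u = (i, i') then 1 else 0) +
    (if u = (j, j') then 1 else 0) - (if u = (i + j, k') then 1 else 0))"
  have v: "lf U \<pi> \<alpha> 0 = int (\<pi> (i, i')) + int (\<pi> (j, j')) - int (\<pi> (i + j, k'))" for \<pi>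
    using presD_finite[OF assms(1)] assms(3-)
    by (simp add: lf_def \<alpha>_def left_diff_distrib distrib_right sum_subtractf sum.distrib if_distrib[of "\<lambda>x. x * _"] cong: if_cong)
  have "sgn (lf U fst \<alpha> 0) = sgn (lf U snd \<alpha> 0)"
    by (rule presD_sgn[OF assms(1)]) (use assms(2) in \<open>auto simp: \<alpha>_def\<close>)
  then show ?thesis by (simp add: v sgn_0_0)
qed

lemma transl_coeff:
  fixes c :: "nat \<times> nat \<Rightarrow> 'a::field"
  assumes "pres C d U" "1 \<le> C" "u \<in> U"
  shows "coeff (\<Sum>u\<in>U. monom (c u) (fst u)) (fst u) = c u"
proof -
  have inj: "inj_on fst U" using pres_functional[OF assms(1,2)] by (force simp: inj_on_def)
  have "coeff (\<Sum>u\<in>U. monom (c u) (fst u)) (fst u) = (\<Sum>w\<in>U. if w = u then c w else 0)"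
    unfolding coeff_sum using inj assms(3) by (intro sum.cong) (auto simp: inj_on_def)
  then show ?thesis using presD_finite[OF assms(1)] assms(3) by simp
qed

text \<open>Sources are distinct, so the coefficients can be read off: 1 at the pair with source
  \<open>i\<close>, and 0 elsewhere.\<close>

lemma transl_monom:
  assumes "(monom 1 i, z') \<in> transl U" "pres C d U" "1 \<le> C"
  obtains j where "(i, j) \<in> U" "z' = monom (1::'a::field) j"
proof -
  obtain c where c: "monom 1 i = (\<Sum>u\<in>U. monom (c u) (fst u))" "z' = (\<Sum>u\<in>U. monom (c u) (snd u))"
    using assms(1) by (rule translE)
  have fin: "finite U" using assms(2) by (rule presD_finite)
  have inj: "inj_on fst U" using pres_functional[OF assms(2,3)] by (force simp: inj_on_def)
  have co: "c u = (if fst u = i then 1 else 0)" if u: "u \<in> U" for u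
    using transl_coeff[OF assms(2,3) u, of c] c(1) by (metis coeff_monom)
  have "i \<in> fst ` U"
  proof (rule ccontr)
    assume "i \<notin> fst ` U"
    then have "(\<Sum>u\<in>U. monom (c u) (fst u)) = 0" using co by (intro sum.neutral) auto
    then show False using c(1) by (metis monom_eq_0_iff zero_neq_one)
  qed
  then obtain j where j: "(i, j) \<in> U" by force
  have "z' = (\<Sum>u\<in>U. if u = (i, j) then monom 1 j else 0)"
    unfolding c(2) using inj j by (intro sum.cong) (auto simp: co inj_on_def)
  then have "z' = monom 1 j" using fin j by simp
  with j show ?thesis by (rule that)
qed

text \<open>Radius 1 reaches the powers of \<open>t\<close>, and 3 is the bound that
  \<open>pres_add\<close> asks for.\<close>

lemma bf_equiv_Rel:
  fixes v w :: "nat \<Rightarrow> 'a::field poly"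
  assumes E: "bf_equiv 1 3 d X v w" and R: "(lc X c1 v, lc X c2 v, lc X c3 v) \<in> mult_powers"
  shows "(lc X c1 w, lc X c2 w, lc X c3 w) \<in> mult_powers"
proof -
  obtain U where U: "pres 3 d U"
      and tr: "\<And>c. wt (lc X c v) \<le> 1 \<Longrightarrow> (lc X c v, lc X c w) \<in> transl U"
    using E by (auto simp: bf_equiv_def)
  obtain i j where ij: "lc X c1 v = monom 1 i" "lc X c2 v = monom 1 j" "lc X c3 v = monom 1 (i + j)"
    using R by (auto simp: mult_powers_def)
  have *: "\<exists>l'. (l, l') \<in> U \<and> lc X c w = monom 1 l'" if "lc X c v = monom 1 l" for c l
    using transl_monom[OF _ U, of l "lc X c w"] tr[of c] wt_monom_le[of "1::'a" l] that by auto
  obtain i' j' k' where "(i, i') \<in> U" "lc X c1 w = monom 1 i'" "(j, j') \<in> U" "lc X c2 w = monom 1 j'"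
    "(i + j, k') \<in> U" "lc X c3 w = monom 1 k'"
    using *[OF ij(1)] *[OF ij(2)] *[OF ij(3)] by auto
  moreover from this have "k' = i' + j'" using pres_add[OF U] by simp
  ultimately show ?thesis by (auto simp: mult_powers_def)
qed

text \<open>The zero polynomial lies within every radius, and distinct sources force all
  coefficients representing it to vanish.\<close>

lemma bf_equiv_Eq:
  assumes E: "bf_equiv N C d X v w" and "1 \<le> C" and z: "lc X c v = 0"
  shows "lc X c w = 0"
proof -
  obtain U where U: "pres C d U"
    and "wt (lc X c v) \<le> N \<Longrightarrow> (lc X c v, lc X c w) \<in> transl U"
    using E by (auto simp: bf_equiv_def)
  then have tr: "(lc X c v, lc X c w) \<in> transl U" by (simp add: z wt_0)
  obtain e where e: "0 = (\<Sum>u\<in>U. monom (e u) (fst u))" "lc X c w = (\<Sum>u\<in>U. monom (e u) (snd u))"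
    using tr unfolding z by (rule translE)
  have "e u = 0" if "u \<in> U" for u
    using transl_coeff[OF U assms(2) that, of e] e(1) by (metis coeff_0)
  then show ?thesis by (simp add: e(2))
qed

text \<open>Induction on \<open>\<phi>\<close>. Negation keeps the bounds, a conjunction takes
  maxima and the product of the moduli, and a quantifier uses \<open>bf_equiv_forth\<close> at the
  price of doubling \<open>N\<close>.\<close>

lemma sat_bf_equiv:
  "\<exists>N C d. d > 0 \<and> (\<forall>X (v :: nat \<Rightarrow> 'a::field poly) w. finite X \<longrightarrow> fv \<phi> \<subseteq> X \<longrightarrow> bf_equiv N C d X v w \<longrightarrow>
     sat (+) mult_powers v \<phi> = sat (+) mult_powers w \<phi>)"
proof (induction \<phi>)
  case (Eq s t)
  obtain c d where "\<forall>v :: nat \<Rightarrow> 'a poly. \<forall>X. finite X \<longrightarrow> fv_tm s \<subseteq> X \<longrightarrow> val (+) v s = lc X c v"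
    "\<forall>v :: nat \<Rightarrow> 'a poly. \<forall>X. finite X \<longrightarrow> fv_tm t \<subseteq> X \<longrightarrow> val (+) v t = lc X d v"
    using val_lc by metis
  then have "sat (+) mult_powers v (Eq s t) \<longleftrightarrow> lc X (\<lambda>x. c x - d x) v = 0"
    if "finite X" "fv (Eq s t) \<subseteq> X" for X and v :: "nat \<Rightarrow> 'a poly"
    using that by (simp flip: lc_diff)
  then show ?case
    by - (rule exI[of _ 0], rule exI[of _ 1], rule exI[of _ 1],
      auto simp del: One_nat_def dest: bf_equiv_Eq[OF _ order_refl] bf_equiv_Eq[OF bf_equiv_sym order_refl])
next
  case (Rel s t u)
  obtain c d e where "\<forall>v :: nat \<Rightarrow> 'a poly. \<forall>X. finite X \<longrightarrow> fv_tm s \<subseteq> X \<longrightarrow> val (+) v s = lc X c v"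
    "\<forall>v :: nat \<Rightarrow> 'a poly. \<forall>X. finite X \<longrightarrow> fv_tm t \<subseteq> X \<longrightarrow> val (+) v t = lc X d v"
    "\<forall>v :: nat \<Rightarrow> 'a poly. \<forall>X. finite X \<longrightarrow> fv_tm u \<subseteq> X \<longrightarrow> val (+) v u = lc X e v"
    using val_lc by metis
  then have "sat (+) mult_powers v (Rel s t u) \<longleftrightarrow> (lc X c v, lc X d v, lc X e v) \<in> mult_powers"
    if "finite X" "fv (Rel s t u) \<subseteq> X" for X and v :: "nat \<Rightarrow> 'a poly"
    using that by simp
  then show ?case
    by - (rule exI[of _ 1], rule exI[of _ 3], rule exI[of _ 1],
      auto simp del: One_nat_def dest: bf_equiv_Rel bf_equiv_Rel[OF bf_equiv_sym])
next
  case (Neg \<phi>)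
  then show ?case by auto
next
  case (Conj \<phi> \<psi>)
  from Conj.IH(1) obtain N C d where 1: "d > 0" "\<And>X (v :: nat \<Rightarrow> 'a poly) w. finite X \<Longrightarrow> fv \<phi> \<subseteq> X \<Longrightarrow>
    bf_equiv N C d X v w \<Longrightarrow> sat (+) mult_powers v \<phi> = sat (+) mult_powers w \<phi>" by blast
  from Conj.IH(2) obtain N' C' d' where 2: "d' > 0" "\<And>X (v :: nat \<Rightarrow> 'a poly) w. finite X \<Longrightarrow> fv \<psi> \<subseteq> X \<Longrightarrow>
    bf_equiv N' C' d' X v w \<Longrightarrow> sat (+) mult_powers v \<psi> = sat (+) mult_powers w \<psi>" by blast
  show ?case
  proof (rule exI[of _ "max N N'"], rule exI[of _ "max C C'"], rule exI[of _ "d * d'"], intro conjI allI impI)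
    show "d * d' > 0" using 1(1) 2(1) by simp
    fix X and v w :: "nat \<Rightarrow> 'a poly"
    assume X: "finite X" "fv (Conj \<phi> \<psi>) \<subseteq> X" and E: "bf_equiv (max N N') (max C C') (d * d') X v w"
    have "bf_equiv N C d X v w" "bf_equiv N' C' d' X v w" by (rule bf_equiv_mono[OF E]; simp)+
    then show "sat (+) mult_powers v (Conj \<phi> \<psi>) = sat (+) mult_powers w (Conj \<phi> \<psi>)"
      using 1(2)[of X v w] 2(2)[of X v w] X by simp
  qed
next
  case (Ex x \<phi>)
  from Ex.IH obtain N C d where d: "d > 0" and IH: "\<And>X (v :: nat \<Rightarrow> 'a poly) w. finite X \<Longrightarrow> fv \<phi> \<subseteq> X \<Longrightarrow>
    bf_equiv N C d X v w \<Longrightarrow> sat (+) mult_powers v \<phi> = sat (+) mult_powers w \<phi>" by blast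
  obtain C' d' where d': "d' > 0" and forth: "\<And>X (v :: nat \<Rightarrow> 'a poly) w x a. finite X \<Longrightarrow> bf_equiv (2 * N) C' d' X v w \<Longrightarrow>
      (\<exists>b. bf_equiv N C d (insert x X) (v(x := a)) (w(x := b)))"
    using bf_equiv_forth[OF d, of N C, where 'a = 'a] by blast
  have half: "sat (+) mult_powers w (Ex x \<phi>)"
    if X: "finite X" "fv (Ex x \<phi>) \<subseteq> X" and E: "bf_equiv (2 * N) C' d' X v w"
      and s: "sat (+) mult_powers v (Ex x \<phi>)" for X and v w :: "nat \<Rightarrow> 'a poly"
  proof -
    obtain a where a: "sat (+) mult_powers (v(x := a)) \<phi>" using s by auto
    obtain b where b: "bf_equiv N C d (insert x X) (v(x := a)) (w(x := b))" using forth[OF X(1) E] by blast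
    have "sat (+) mult_powers (w(x := b)) \<phi>" using IH[OF _ _ b] X a by auto
    then show ?thesis by auto
  qed
  have "sat (+) mult_powers v (Ex x \<phi>) = sat (+) mult_powers w (Ex x \<phi>)"
    if "finite X" "fv (Ex x \<phi>) \<subseteq> X" "bf_equiv (2 * N) C' d' X v w" for X and v w :: "nat \<Rightarrow> 'a poly"
    using half[OF that] half[OF that(1,2) bf_equiv_sym[OF that(3)]] by (rule iffI)
  then show ?case using d' by - (rule exI[of _ "2 * N"], rule exI[of _ C'], rule exI[of _ d'], blast)
qed

section \<open>Counting types\<close>

text \<open>The cut points: values at points of \<open>P\<close> of integer forms with at most
  \<open>r\<close> terms and with coefficients and constant bounded by \<open>C\<close>. The extra
  point 0 pads shorter forms.\<close>

fun small_combs :: "nat set \<Rightarrow> nat \<Rightarrow> nat \<Rightarrow> int set" where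
  "small_combs P C 0 = {- int C..int C}"
| "small_combs P C (Suc r) = (\<lambda>(s, q, \<alpha>). s + \<alpha> * int q) ` (small_combs P C r \<times> insert 0 P \<times> {- int C..int C})"

lemma card_symmetric_box: "card {- int C..int C} = 2 * C + 1"
  by simp

lemma finite_small_combs: "finite P \<Longrightarrow> finite (small_combs P C r)"
  by (induction r) auto

lemma card_small_combs:
  assumes "finite P" "card P \<le> p"
  shows "card (small_combs P C r) \<le> (2 * C + 1) * ((p + 1) * (2 * C + 1)) ^ r"
proof (induction r)
  case 0 then show ?case by simp
next
  case (Suc r)
  have "card (small_combs P C (Suc r)) \<le> card (small_combs P C r \<times> insert 0 P \<times> {- int C..int C})"
    unfolding small_combs.simps by (rule card_image_le) (use assms finite_small_combs in auto)
  also have "\<dots> = card (small_combs P C r) * (card (insert 0 P) * (2 * C + 1))"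
    by (simp only: card_cartesian_product card_symmetric_box)
  also have "\<dots> \<le> ((2 * C + 1) * ((p + 1) * (2 * C + 1)) ^ r) * ((p + 1) * (2 * C + 1))"
    by (intro mult_le_mono Suc.IH order_refl) (use assms in \<open>auto simp: card_insert_if\<close>)
  finally show ?case by (simp add: algebra_simps)
qed

lemma sum_in_small_combs:
  assumes "finite F" "F \<subseteq> P" "card F \<le> r" "\<And>q. q \<in> F \<Longrightarrow> \<bar>\<alpha> q\<bar> \<le> int C" "\<bar>c\<bar> \<le> int C"
  shows "(\<Sum>q\<in>F. \<alpha> q * int q) + c \<in> small_combs P C r"
  using assms
proof (induction r arbitrary: F)
  case 0 then show ?case by auto
next
  case (Suc r)
  show ?case
  proof (cases "F = {}")
    case True
    have "c \<in> small_combs P C r" using Suc.IH[of "{}"] Suc.prems(5) by simp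
    then show ?thesis unfolding True small_combs.simps by (intro image_eqI[of _ _ "(c, 0, 0)"]) auto
  next
    case False
    then obtain q where q: "q \<in> F" by auto
    have "(\<Sum>q\<in>F - {q}. \<alpha> q * int q) + c \<in> small_combs P C r"
      using Suc.prems q by (intro Suc.IH) (auto simp: card_Diff_singleton)
    moreover have "q \<in> P" "\<alpha> q \<in> {- int C..int C}" using Suc.prems(2) Suc.prems(4)[of q] q by auto
    moreover have "(\<Sum>q\<in>F. \<alpha> q * int q) + c = ((\<Sum>q\<in>F - {q}. \<alpha> q * int q) + c) + \<alpha> q * int q"
      using Suc.prems(1) q by (simp add: sum.remove)
    ultimately show ?thesis unfolding small_combs.simps
      by (intro image_eqI[of _ _ "((\<Sum>q\<in>F - {q}. \<alpha> q * int q) + c, q, \<alpha> q)"]) auto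
  qed
qed

text \<open>Initial segments of \<open>Q\<close> are nested, so equal cardinalities force equality.
  Two numbers up to \<open>card Q\<close> thus record a position relative to all cut points.\<close>

lemma initial_segment_card_eq:
  fixes Q :: "int set"
  assumes "finite Q" "card {q \<in> Q. q < x} = card {q \<in> Q. q < y}" "card {q \<in> Q. q \<le> x} = card {q \<in> Q. q \<le> y}" "q \<in> Q"
  shows "sgn (x - q) = sgn (y - q)"
proof -
  have lt: "{q \<in> Q. q < x} = {q \<in> Q. q < y}"
  proof (cases "x \<le> y")
    case True then show ?thesis using assms by (intro card_subset_eq) auto
  next
    case False then show ?thesis using assms by (intro card_subset_eq[symmetric]) auto
  qed
  have le: "{q \<in> Q. q \<le> x} = {q \<in> Q. q \<le> y}"
  proof (cases "x \<le> y")
    case True then show ?thesis using assms by (intro card_subset_eq) auto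
  next
    case False then show ?thesis using assms by (intro card_subset_eq[symmetric]) auto
  qed
  have "q < x \<longleftrightarrow> q < y" "q \<le> x \<longleftrightarrow> q \<le> y" using lt le assms(4) by blast+
  then show ?thesis by (auto simp: sgn_if)
qed

text \<open>For each of the \<open>(2 * C + 1) ^ j\<close> coefficient vectors on \<open>j\<close>
  exponents, a pair of cardinalities locates the form among the cut points; \<open>d ^ j\<close>
  counts residues. In \<open>p\<close> alone this is a polynomial.\<close>

definition pres_bound :: "nat \<Rightarrow> nat \<Rightarrow> nat \<Rightarrow> nat \<Rightarrow> nat \<Rightarrow> nat" where
  "pres_bound C d r j p = (((2 * C + 1) * ((p + 1) * (2 * C + 1)) ^ r + 1) ^ 2) ^ ((2 * C + 1) ^ j) * d ^ j"

text \<open>The fixed exponents enter only through cut points, and the moving exponents are treated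
  as families over \<open>J\<close>, which is the shape in which colours record them.\<close>

lemma pres_Id_Un:
  fixes e e' :: "'j \<Rightarrow> nat"
  assumes fin: "finite J" "finite P'"
    and pos: "\<And>\<beta> \<gamma> c. (\<And>j. j \<in> J \<Longrightarrow> \<bar>\<beta> j\<bar> \<le> int C) \<Longrightarrow> (\<And>q. q \<in> P' \<Longrightarrow> \<bar>\<gamma> q\<bar> \<le> int C) \<Longrightarrow> \<bar>c\<bar> \<le> int C \<Longrightarrow>
      sgn ((\<Sum>j\<in>J. \<beta> j * int (e j)) - ((\<Sum>q\<in>P'. \<gamma> q * int q) + c)) =
      sgn ((\<Sum>j\<in>J. \<beta> j * int (e' j)) - ((\<Sum>q\<in>P'. \<gamma> q * int q) + c))"
    and res: "\<And>j. j \<in> J \<Longrightarrow> e j mod d = e' j mod d"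
  shows "pres C d (Id_on P' \<union> (\<lambda>j. (e j, e' j)) ` J)"
  unfolding pres_def
proof (intro conjI allI impI ballI)
  have fI: "finite (Id_on P')" by (rule finite_subset[of _ "P' \<times> P'"]) (use fin in auto)
  then show "finite (Id_on P' \<union> (\<lambda>j. (e j, e' j)) ` J)" using fin by simp
  fix \<alpha> :: "nat \<times> nat \<Rightarrow> int" and c
  let ?f = "\<lambda>j. (e j, e' j)"
  assume a: "\<forall>u\<in>Id_on P' \<union> ?f ` J. \<bar>\<alpha> u\<bar> \<le> int C" and c: "\<bar>c\<bar> \<le> int C"
  \<comment> \<open>Pairs may repeat or lie on the diagonal. \<open>J'\<close> keeps one index for
    each pair off the diagonal, and the other indices get coefficient 0.\<close>
  obtain J' where J': "J' \<subseteq> J" "inj_on ?f J'" "?f ` J - Id_on P' = ?f ` J'"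
    using subset_image_inj[of "?f ` J - Id_on P'" ?f J] by auto
  define \<beta> where "\<beta> j = (if j \<in> J' then \<alpha> (?f j) else 0)" for j
  define \<gamma> where "\<gamma> q = - \<alpha> (q, q)" for q
  have Ieq: "Id_on P' = (\<lambda>q. (q, q)) ` P'" by auto
  have Ueq: "Id_on P' \<union> ?f ` J = Id_on P' \<union> ?f ` J'" using J'(3) by auto
  have fJ': "finite J'" using J'(1) fin(1) finite_subset by blast
  have *: "lf (Id_on P' \<union> ?f ` J) \<pi> \<alpha> c = (\<Sum>j\<in>J. \<beta> j * int (\<pi> (?f j))) - ((\<Sum>q\<in>P'. \<gamma> q * int q) + - c)"
    if \<pi>: "\<And>q. \<pi> (q, q) = q" for \<pi>
  proof -
    have "lf (Id_on P' \<union> ?f ` J) \<pi> \<alpha> c = (\<Sum>u\<in>Id_on P'. \<alpha> u * int (\<pi> u)) + (\<Sum>u\<in>?f ` J'. \<alpha> u * int (\<pi> u)) + c"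
      unfolding lf_def Ueq using fI fJ' J'(3) by (subst sum.union_disjoint) auto
    also have "(\<Sum>u\<in>Id_on P'. \<alpha> u * int (\<pi> u)) = (\<Sum>q\<in>P'. \<alpha> (q, q) * int q)"
      unfolding Ieq by (subst sum.reindex) (auto simp: inj_on_def \<pi>)
    also have "(\<Sum>u\<in>?f ` J'. \<alpha> u * int (\<pi> u)) = (\<Sum>j\<in>J'. \<alpha> (?f j) * int (\<pi> (?f j)))"
      using J'(2) by (subst sum.reindex) auto
    also have "\<dots> = (\<Sum>j\<in>J. \<beta> j * int (\<pi> (?f j)))"
      by (rule sum.mono_neutral_cong_left) (use fin J' in \<open>auto simp: \<beta>_def\<close>)
    finally show ?thesis by (simp add: \<gamma>_def sum_negf)
  qed
  have "\<bar>\<beta> j\<bar> \<le> int C" if "j \<in> J" for j using a that J'(1) by (auto simp: \<beta>_def)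
  moreover have "\<bar>\<gamma> q\<bar> \<le> int C" if "q \<in> P'" for q using a that by (auto simp: \<gamma>_def)
  ultimately show "sgn (lf (Id_on P' \<union> ?f ` J) fst \<alpha> c) = sgn (lf (Id_on P' \<union> ?f ` J) snd \<alpha> c)"
    using pos[of \<beta> \<gamma> "- c"] c by (simp add: *)
next
  fix u assume "u \<in> Id_on P' \<union> (\<lambda>j. (e j, e' j)) ` J"
  then show "int d dvd int (fst u) - int (snd u)"
  proof
    assume "u \<in> (\<lambda>j. (e j, e' j)) ` J"
    then obtain j where "j \<in> J" "u = (e j, e' j)" by auto
    then show ?thesis using res[of j] by (simp flip: mod_eq_dvd_iff of_nat_mod)
  qed auto
qed

text \<open>The colour holds the position of every bounded form in \<open>e\<close> among the cut
  points over all of \<open>P\<close>, and the residues modulo \<open>d\<close>. Cut points use up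
  to \<open>r\<close> points of \<open>P\<close>, so one colour decides the type over every small
  \<open>P'\<close> at once.\<close>

lemma pres_colouring:
  fixes J :: "'j set"
  assumes J: "finite J" and P: "finite P" "card P \<le> p" and d: "d > 0"
  obtains S and col :: "('j \<Rightarrow> nat) \<Rightarrow> (('j \<Rightarrow> int) \<Rightarrow> nat \<times> nat) \<times> ('j \<Rightarrow> nat)"
  where "finite S" "card S \<le> pres_bound C d r (card J) p" "\<And>e. col e \<in> S"
    "\<And>e e' P'. col e = col e' \<Longrightarrow> P' \<subseteq> P \<Longrightarrow> card P' \<le> r \<Longrightarrow> pres C d (Id_on P' \<union> (\<lambda>j. (e j, e' j)) ` J)"
proof
  define Q where "Q = small_combs P C r"
  define B where "B = PiE J (\<lambda>_. {- int C..int C})"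
  define ev where "ev \<beta> e = (\<Sum>j\<in>J. \<beta> j * int (e j))" for \<beta> :: "'j \<Rightarrow> int" and e :: "'j \<Rightarrow> nat"
  define pos where "pos x = (card {q \<in> Q. q < x}, card {q \<in> Q. q \<le> x})" for x :: int
  define col where "col e = (restrict (\<lambda>\<beta>. pos (ev \<beta> e)) B, restrict (\<lambda>j. e j mod d) J)" for e
  define S where "S = PiE B (\<lambda>_. {0..card Q} \<times> {0..card Q}) \<times> PiE J (\<lambda>_. {0..<d})"
  have fQ: "finite Q" using P by (simp add: Q_def finite_small_combs)
  have fB: "finite B" using J by (simp add: B_def finite_PiE)
  have cB: "card B = (2 * C + 1) ^ card J" using J by (simp only: B_def card_PiE card_symmetric_box prod_constant)
  show "finite S" using fB J by (simp add: S_def finite_PiE)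
  have "card S = ((card Q + 1) ^ 2) ^ card B * d ^ card J"
    using fB J by (simp add: S_def card_cartesian_product card_PiE power2_eq_square)
  also have "\<dots> \<le> pres_bound C d r (card J) p"
    unfolding pres_bound_def cB Q_def
    by (intro mult_le_mono power_mono add_mono card_small_combs P order_refl) auto
  finally show "card S \<le> pres_bound C d r (card J) p" .
  show "col e \<in> S" for e
    using fQ d by (auto simp: col_def S_def pos_def intro!: restrict_PiE_iff[THEN iffD2] card_mono)
  fix e e' P' assume eq: "col e = col e'" and P': "P' \<subseteq> P" "card P' \<le> r"
  have fP': "finite P'" using P' P finite_subset by blast
  show "pres C d (Id_on P' \<union> (\<lambda>j. (e j, e' j)) ` J)"
  proof (rule pres_Id_Un[OF J fP'])
    fix j assume "j \<in> J"
    then show "e j mod d = e' j mod d" using eq by (auto simp: col_def dest!: fun_cong[where x = j])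
  next
    fix \<beta> :: "'j \<Rightarrow> int" and \<gamma> :: "nat \<Rightarrow> int" and c
    assume \<beta>: "\<And>j. j \<in> J \<Longrightarrow> \<bar>\<beta> j\<bar> \<le> int C" and \<gamma>: "\<And>q. q \<in> P' \<Longrightarrow> \<bar>\<gamma> q\<bar> \<le> int C" and c: "\<bar>c\<bar> \<le> int C"
    have q: "(\<Sum>q\<in>P'. \<gamma> q * int q) + c \<in> Q"
      unfolding Q_def by (rule sum_in_small_combs) (use fP' P' \<gamma> c in auto)
    have "- int C \<le> \<beta> j \<and> \<beta> j \<le> int C" if "j \<in> J" for j using \<beta>[OF that] by linarith
    then have "restrict \<beta> J \<in> B" by (auto simp: B_def)
    moreover have "restrict (\<lambda>\<beta>. pos (ev \<beta> e)) B = restrict (\<lambda>\<beta>. pos (ev \<beta> e')) B"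
      using eq by (simp add: col_def)
    ultimately have "pos (ev (restrict \<beta> J) e) = pos (ev (restrict \<beta> J) e')"
      by (metis restrict_apply')
    then have "sgn (ev (restrict \<beta> J) e - ((\<Sum>q\<in>P'. \<gamma> q * int q) + c)) = sgn (ev (restrict \<beta> J) e' - ((\<Sum>q\<in>P'. \<gamma> q * int q) + c))"
      by (intro initial_segment_card_eq[OF fQ _ _ q]) (auto simp: pos_def)
    then show "sgn ((\<Sum>j\<in>J. \<beta> j * int (e j)) - ((\<Sum>q\<in>P'. \<gamma> q * int q) + c)) =
      sgn ((\<Sum>j\<in>J. \<beta> j * int (e' j)) - ((\<Sum>q\<in>P'. \<gamma> q * int q) + c))"
      by (simp add: ev_def)
  qed
qed

section \<open>Colouring tuples by their sparse approximations\<close>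

lemma monom_sum_representation:
  fixes z :: "'a::field poly"
  assumes "wt z \<le> N"
  shows "\<exists>c e. z = (\<Sum>j<N. monom (c j) (e j))"
proof -
  obtain f where f: "bij_betw f {..<wt z} (supp z)"
    using ex_bij_betw_nat_finite[OF finite_supp[of z]] by (auto simp: atLeast0LessThan)
  have "z = (\<Sum>j<wt z. monom (coeff z (f j)) (f j))"
    using sum.reindex_bij_betw[OF f, of "\<lambda>i. monom (coeff z i) i"] by (simp add: sum_monom_supp)
  \<comment> \<open>Spare slots carry coefficient 0, so that all sparse remainders have the same
    index set.\<close>
  also have "\<dots> = (\<Sum>j<N. monom (if j < wt z then coeff z (f j) else 0) (f j))"
    by (rule sum.mono_neutral_cong_left) (use assms in auto)
  finally show ?thesis by (intro exI)
qed

definition small_diff :: "nat \<Rightarrow> 'a::field poly \<Rightarrow> 'a poly \<Rightarrow> nat set" where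
  "small_diff N h w = (if wt (h - w) \<le> N then supp (h - w) else {})"

lemma card_small_diff: "card (small_diff N h w) \<le> N" and finite_small_diff: "finite (small_diff N h w)"
  by (auto simp: small_diff_def finite_supp)

lemma card_UN_le_mult:
  assumes "finite I" "\<And>i. i \<in> I \<Longrightarrow> card (A i) \<le> b"
  shows "card (\<Union>i\<in>I. A i) \<le> card I * b"
proof -
  have "card (\<Union>i\<in>I. A i) \<le> (\<Sum>i\<in>I. card (A i))" by (rule card_UN_le[OF assms(1)])
  also have "\<dots> \<le> card I * b" using sum_bounded_above[of I "\<lambda>i. card (A i)" b] assms(2) by simp
  finally show ?thesis .
qed

text \<open>Here \<open>m\<close> forms in the varying tuple face \<open>w\<close> fixed elements
  over a field of size \<open>q\<close>. The factors count the near element, or none, for each form;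
  the coefficients of the remainders; and the Presburger type of their \<open>m * N\<close>
  exponents over the supports of sparse differences of fixed elements.\<close>

definition colour_bound :: "nat \<Rightarrow> nat \<Rightarrow> nat \<Rightarrow> nat \<Rightarrow> nat \<Rightarrow> nat \<Rightarrow> nat \<Rightarrow> nat" where
  "colour_bound q N C d r m w = (w + 1) ^ m * q ^ (m * N) *
     pres_bound C d (r * m * (2 * N)) (m * N) (w * w * (2 * N))"

type_synonym ('m, 'a) colour =
  "('m \<Rightarrow> 'a poly option) \<times> ('m \<times> nat \<Rightarrow> 'a) \<times> (('m \<times> nat \<Rightarrow> int) \<Rightarrow> nat \<times> nat) \<times> ('m \<times> nat \<Rightarrow> nat)"

text \<open>If \<open>w\<close> is the element recorded for \<open>\<mu>\<close>, then
  \<open>h + D \<mu> y = (h - w) + (D \<mu> y + w)\<close>. When the left side is sparse, so is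
  \<open>h - w\<close>, and \<open>U\<close> fixes its exponents; the second summand has the same
  coefficients for \<open>y\<close> and \<open>y'\<close> and its exponents are moved by
  \<open>U\<close>.\<close>

lemma approximation_colouring:
  fixes D :: "'m \<Rightarrow> 'y \<Rightarrow> 'a::field poly" and W :: "'a poly set"
  assumes fin: "finite W" "finite M" "finite (UNIV :: 'a set)" and d: "d > 0"
  obtains S and col :: "'y \<Rightarrow> ('m, 'a) colour"
  where "finite S" "card S \<le> colour_bound CARD('a) N C d r (card M) (card W)" "\<And>y. col y \<in> S"
    "\<And>y y' H. col y = col y' \<Longrightarrow> H \<subseteq> W \<Longrightarrow> card H \<le> r \<Longrightarrow>
      \<exists>U. pres C d U \<and> (\<forall>h\<in>H. \<forall>\<mu>\<in>M. wt (h + D \<mu> y) \<le> N \<or> wt (h + D \<mu> y') \<le> N \<longrightarrow>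
        (h + D \<mu> y, h + D \<mu> y') \<in> transl U)"
proof -
  define near where "near y \<mu> w \<longleftrightarrow> w \<in> W \<and> wt (D \<mu> y + w) \<le> N" for y \<mu> w
  \<comment> \<open>The choice is arbitrary but part of the colour, so equal colours refer both
    tuples to the same \<open>w\<close>.\<close>
  define g where "g y \<mu> = (if \<exists>w. near y \<mu> w then Some (SOME w. near y \<mu> w) else None)" for y \<mu>
  have gS: "near y \<mu> w" if "g y \<mu> = Some w" for y \<mu> w
    using that someI_ex[of "near y \<mu>"] by (auto simp: g_def split: if_splits)
  have gN: "\<not> near y \<mu> w" if "g y \<mu> = None" for y \<mu> w
    using that by (auto simp: g_def split: if_splits)
  define z where "z y \<mu> = (case g y \<mu> of None \<Rightarrow> 0 | Some w \<Rightarrow> D \<mu> y + w)" for y \<mu>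
  have "wt (z y \<mu>) \<le> N" for y \<mu>
    using gS[of y \<mu>] by (auto simp: z_def near_def wt_0 split: option.split)
  then have "\<exists>c e. z y \<mu> = (\<Sum>j<N. monom (c j) (e j))" for y \<mu>
    by (rule monom_sum_representation)
  then obtain cf0 ex0 where zr0: "\<And>y \<mu>. z y \<mu> = (\<Sum>j<N. monom (cf0 y \<mu> j) (ex0 y \<mu> j))" by metis
  define cf where "cf y p = cf0 y (fst p) (snd p)" for y p
  define ex where "ex y p = ex0 y (fst p) (snd p)" for y p
  have zr: "z y \<mu> = (\<Sum>j<N. monom (cf y (\<mu>, j)) (ex y (\<mu>, j)))" for y \<mu>
    using zr0[of y \<mu>] by (simp add: cf_def ex_def)
  define J where "J = M \<times> {..<N}"
  have fJ: "finite J" and cJ: "card J = card M * N" using fin by (auto simp: J_def)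
  define P where "P = (\<Union>(w, w')\<in>W \<times> W. small_diff (2 * N) w w')"
  have fP: "finite P" using fin by (auto simp: P_def finite_small_diff)
  have cP: "card P \<le> card W * card W * (2 * N)"
    unfolding P_def card_cartesian_product[symmetric]
    by (rule card_UN_le_mult) (use fin card_small_diff in auto)
  obtain T and pcol :: "('m \<times> nat \<Rightarrow> nat) \<Rightarrow> (('m \<times> nat \<Rightarrow> int) \<Rightarrow> nat \<times> nat) \<times> ('m \<times> nat \<Rightarrow> nat)"
    where T: "finite T" "card T \<le> pres_bound C d (r * card M * (2 * N)) (card J) (card W * card W * (2 * N))"
      "\<And>e. pcol e \<in> T"
    and pcol: "\<And>e e' P'. pcol e = pcol e' \<Longrightarrow> P' \<subseteq> P \<Longrightarrow> card P' \<le> r * card M * (2 * N) \<Longrightarrow>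
      pres C d (Id_on P' \<union> (\<lambda>j. (e j, e' j)) ` J)"
    by (rule pres_colouring[OF fJ fP cP d, of C "r * card M * (2 * N)"]) blast
  define col where "col y = (restrict (g y) M, restrict (cf y) J, pcol (ex y))" for y
  \<comment> \<open>Coefficients are recorded exactly, which is where finiteness of the field
    enters.\<close>
  define S where "S = PiE M (\<lambda>_. insert None (Some ` W)) \<times> PiE J (\<lambda>_. UNIV :: 'a set) \<times> T"
  show ?thesis
  proof (rule that[of S col])
    show "finite S" using fin fJ T(1) by (simp add: S_def finite_PiE)
    have "card (insert None (Some ` W)) = card W + 1" using fin(1) by (simp add: card_image)
    then have "card S = (card W + 1) ^ card M * CARD('a) ^ (card M * N) * card T"
      using fin fJ by (simp add: S_def card_cartesian_product card_PiE cJ)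
    also have "\<dots> \<le> colour_bound CARD('a) N C d r (card M) (card W)"
      unfolding colour_bound_def using T(2) by (simp add: cJ)
    finally show "card S \<le> colour_bound CARD('a) N C d r (card M) (card W)" .
    have "g y \<mu> \<in> insert None (Some ` W)" for y \<mu>
      using gS[of y \<mu>] by (cases "g y \<mu>") (auto simp: near_def)
    then show "col y \<in> S" for y
      using T(3) by (simp add: col_def S_def del: insert_iff)
    fix y y' H assume eq: "col y = col y'" and H: "H \<subseteq> W" "card H \<le> r"
    have r: "restrict (g y) M = restrict (g y') M" "restrict (cf y) J = restrict (cf y') J"
      "pcol (ex y) = pcol (ex y')"
      using eq by (simp_all add: col_def)
    have geq: "g y \<mu> = g y' \<mu>" if "\<mu> \<in> M" for \<mu> using r(1) that by (metis restrict_apply')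
    have ceq: "cf y j = cf y' j" if "j \<in> J" for j using r(2) that by (metis restrict_apply')
    \<comment> \<open>Only differences of elements of \<open>H\<close> with recorded elements
      matter, so the size of \<open>P'\<close> is bounded independently of
      \<open>card W\<close>.\<close>
    define P' where "P' = (\<Union>(h, \<mu>)\<in>H \<times> M. case g y \<mu> of None \<Rightarrow> {} | Some w \<Rightarrow> small_diff (2 * N) h w)"
    have fH: "finite H" using H fin finite_subset by blast
    have "P' \<subseteq> P"
      using gS H(1) by (fastforce simp: P'_def P_def near_def split: option.splits)
    moreover have "card P' \<le> card (H \<times> M) * (2 * N)"
      unfolding P'_def by (rule card_UN_le_mult) (use fH fin card_small_diff in \<open>auto split: option.split\<close>)
    then have "card P' \<le> r * card M * (2 * N)"
      unfolding card_cartesian_product using H(2) by (meson le_trans mult_le_mono1)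
    ultimately have U: "pres C d (Id_on P' \<union> (\<lambda>j. (ex y j, ex y' j)) ` J)" (is "pres C d ?U")
      using pcol r(3) by blast
    show "\<exists>U. pres C d U \<and> (\<forall>h\<in>H. \<forall>\<mu>\<in>M. wt (h + D \<mu> y) \<le> N \<or> wt (h + D \<mu> y') \<le> N \<longrightarrow>
        (h + D \<mu> y, h + D \<mu> y') \<in> transl U)"
    proof (intro exI conjI ballI impI, rule U)
      fix h \<mu> assume h: "h \<in> H" and \<mu>: "\<mu> \<in> M" and small: "wt (h + D \<mu> y) \<le> N \<or> wt (h + D \<mu> y') \<le> N"
      have "near y \<mu> h \<or> near y' \<mu> h" using small h H(1) by (auto simp: near_def add.commute)
      then obtain w where w: "g y \<mu> = Some w" "g y' \<mu> = Some w"
        using gN geq[OF \<mu>] by (metis option.exhaust)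
      have "wt (D \<mu> y + w) \<le> N" "wt (D \<mu> y' + w) \<le> N" using gS w by (auto simp: near_def)
      \<comment> \<open>Stated for any \<open>u\<close>, as the sparse combination may be the one at
        \<open>y\<close> or the one at \<open>y'\<close>.\<close>
      moreover have "h - w = (h + D \<mu> u) - (D \<mu> u + w)" for u by simp
      ultimately have hw: "wt (h - w) \<le> 2 * N"
        using small wt_diff_le by (metis (no_types, lifting) add_mono mult_2 order_trans)
      have "supp (h - w) \<subseteq> P'" using h \<mu> w(1) hw by (force simp: P'_def small_diff_def)
      then have "(h - w, h - w) \<in> transl ?U"
        using transl_sum_monom[OF presD_finite[OF U], of "supp (h - w)" "\<lambda>i. i" "\<lambda>i. i" "coeff (h - w)"]
        by (auto simp del: coeff_diff simp: sum_monom_supp)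
      moreover have "(D \<mu> y + w, D \<mu> y' + w) \<in> transl ?U"
      proof -
        have "D \<mu> y + w = (\<Sum>j<N. monom (cf y (\<mu>, j)) (ex y (\<mu>, j)))"
          using zr[of y \<mu>] w by (simp add: z_def)
        moreover have "D \<mu> y' + w = (\<Sum>j<N. monom (cf y (\<mu>, j)) (ex y' (\<mu>, j)))"
          using zr[of y' \<mu>] w ceq \<mu> by (simp add: z_def J_def)
        ultimately show ?thesis
          using \<mu> by (auto simp: J_def intro!: transl_sum_monom presD_finite[OF U[unfolded J_def]])
      qed
      ultimately have "((h - w) + (D \<mu> y + w), (h - w) + (D \<mu> y' + w)) \<in> transl ?U"
        by (rule transl_add)
      then show "(h + D \<mu> y, h + D \<mu> y') \<in> transl ?U" by (simp add: algebra_simps)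
    qed
  qed
qed

section \<open>Polynomial against exponential growth\<close>

definition poly_bounded :: "(nat \<Rightarrow> nat) \<Rightarrow> bool" where
  "poly_bounded f \<longleftrightarrow> (\<exists>A D. \<forall>k. f k \<le> A * (k + 1) ^ D)"

lemma poly_bounded_const: "poly_bounded (\<lambda>_. c)"
  unfolding poly_bounded_def by (rule exI[of _ c], rule exI[of _ 0]) simp

lemma poly_bounded_id: "poly_bounded (\<lambda>k. k)"
  unfolding poly_bounded_def by (rule exI[of _ 1], rule exI[of _ 1]) simp

lemma poly_bounded_mult:
  assumes "poly_bounded f" "poly_bounded g"
  shows "poly_bounded (\<lambda>k. f k * g k)"
proof -
  obtain A D B E where "\<And>k. f k \<le> A * (k + 1) ^ D" "\<And>k. g k \<le> B * (k + 1) ^ E"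
    using assms by (auto simp: poly_bounded_def)
  then have "f k * g k \<le> (A * B) * (k + 1) ^ (D + E)" for k
    using mult_le_mono[of "f k" _ "g k"] by (fastforce simp: power_add ac_simps)
  then show ?thesis unfolding poly_bounded_def by blast
qed

lemma poly_bounded_add:
  assumes "poly_bounded f" "poly_bounded g"
  shows "poly_bounded (\<lambda>k. f k + g k)"
proof -
  obtain A D B E where *: "\<And>k. f k \<le> A * (k + 1) ^ D" "\<And>k. g k \<le> B * (k + 1) ^ E"
    using assms by (auto simp: poly_bounded_def)
  have "f k + g k \<le> (A + B) * (k + 1) ^ (D + E)" for k
  proof -
    have "f k \<le> A * (k + 1) ^ (D + E)" "g k \<le> B * (k + 1) ^ (D + E)"
      by (rule order_trans[OF *(1)] order_trans[OF *(2)], intro mult_le_mono2 power_increasing; simp)+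
    then show ?thesis by (simp add: distrib_right)
  qed
  then show ?thesis unfolding poly_bounded_def by blast
qed

lemma poly_bounded_power: "poly_bounded f \<Longrightarrow> poly_bounded (\<lambda>k. f k ^ n)"
  by (induction n) (auto intro: poly_bounded_const poly_bounded_mult)

text \<open>The varying argument \<open>k * s\<close> occurs only in bases; all exponents are
  constant.\<close>

lemma poly_bounded_colour_bound: "poly_bounded (\<lambda>k. colour_bound q N C d r m (k * s))"
  unfolding colour_bound_def pres_bound_def
  by (intro poly_bounded_mult poly_bounded_add poly_bounded_power poly_bounded_const poly_bounded_id)

lemma poly_bounded_less_exp:
  assumes "poly_bounded f"
  shows "\<exists>k. f k < 2 ^ k"
proof -
  obtain A D where AD: "\<And>k. f k \<le> A * (k + 1) ^ D" using assms by (auto simp: poly_bounded_def)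
  define s where "s = A + D + 1"
  \<comment> \<open>With \<open>k + 1\<close> a power of 2, the bound becomes
    \<open>A * 2 ^ (3 * s * D)\<close>, and the 3 allows a comparison with the cube of
    \<open>s + 1\<close>.\<close>
  define k where "k = 2 ^ (3 * s) - (1::nat)"
  have k: "k + 1 = 2 ^ (3 * s)" by (simp add: k_def)
  have "s + 1 \<le> 2 ^ s" by (simp add: Suc_le_eq)
  then have "(s + 1) ^ 3 \<le> (2 ^ s) ^ 3" by (rule power_mono) simp
  then have "(s + 1) ^ 3 \<le> k + 1" by (simp only: k power_mult[symmetric] mult.commute)
  moreover have "A + 3 * s * D + 1 \<le> (s + 1) ^ 3"
  proof -
    have "D \<le> s" "A \<le> s" by (auto simp: s_def)
    then have "3 * s * D \<le> 3 * s * s" "A \<le> s" by (simp_all only: mult_le_mono2)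
    moreover have "(s + 1) ^ 3 = s * s * s + 3 * s * s + 3 * s + 1"
      by (simp add: power3_eq_cube algebra_simps)
    ultimately show ?thesis by linarith
  qed
  ultimately have e: "A + 3 * s * D \<le> k" by linarith
  have "f k \<le> A * 2 ^ (3 * s * D)" using AD[of k] unfolding k by (simp add: power_mult)
  also have "\<dots> < 2 ^ A * 2 ^ (3 * s * D)" by simp
  also have "\<dots> \<le> 2 ^ k" unfolding power_add[symmetric] using e by (rule power_increasing) simp
  finally show ?thesis ..
qed

text \<open>Restriction puts the two coefficient functions into finite sets of extensional
  functions, which can be counted.\<close>

lemma lc_append:
  assumes "length a = m"
  shows "lc {..<m + n} c ((!) (a @ y)) = lc {..<m} (restrict c {..<m}) ((!) a) +
    lc {..<n} (restrict (\<lambda>j. c (m + j)) {..<n}) ((!) y)"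
proof -
  have "x \<in> (+) m ` {..<n}" if "x < m + n" "\<not> x < m" for x
    using that by (intro image_eqI[of _ _ "x - m"]) auto
  then have "{..<m + n} = {..<m} \<union> (+) m ` {..<n}" by auto
  moreover have "{..<m} \<inter> (+) m ` {..<n} = {}" by auto
  ultimately have "lc {..<m + n} c ((!) (a @ y)) =
    (\<Sum>x<m. smult (c x) ((a @ y) ! x)) + (\<Sum>x\<in>(+) m ` {..<n}. smult (c x) ((a @ y) ! x))"
    unfolding lc_def by (simp add: sum.union_disjoint)
  also have "(\<Sum>x\<in>(+) m ` {..<n}. smult (c x) ((a @ y) ! x)) = (\<Sum>j<n. smult (c (m + j)) (y ! j))"
    by (subst sum.reindex) (auto simp: assms nth_append)
  finally show ?thesis by (simp add: lc_def nth_append assms)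
qed

text \<open>Pigeonhole: for a suitable \<open>k\<close>, the \<open>2 ^ k\<close> parameters
  \<open>b I\<close> have fewer colours, and two of equal colour satisfy \<open>\<phi>\<close> with
  the same \<open>a i\<close>.\<close>

theorem NIP_mult_powers:
  assumes fin: "finite (UNIV :: 'a::field set)"
  shows "NIP ((+) :: 'a poly \<Rightarrow> 'a poly \<Rightarrow> 'a poly) mult_powers"
  unfolding NIP_def has_IP_def
proof (intro allI impI notI)
  fix \<phi> m n
  assume fv: "fv \<phi> \<subseteq> {..<m + n}" and IP: "\<forall>k. shatters_size ((+) :: 'a poly \<Rightarrow> _) mult_powers \<phi> m n k"
  obtain N C d where d: "d > 0" and sat: "\<And>v w :: nat \<Rightarrow> 'a poly. bf_equiv N C d {..<m + n} v w \<Longrightarrow>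
      sat (+) mult_powers v \<phi> = sat (+) mult_powers w \<phi>"
    using sat_bf_equiv[of \<phi>, where 'a = 'a] fv by (metis finite_lessThan)
  define L where "L l = PiE {..<l} (\<lambda>_. UNIV :: 'a set)" for l :: nat
  have fL: "finite (L l)" for l using fin by (simp add: L_def finite_PiE)
  obtain k where k: "colour_bound CARD('a) N C d (card (L m)) (card (L n)) (k * card (L m)) < 2 ^ k"
    using poly_bounded_less_exp[OF poly_bounded_colour_bound] by blast
  from IP have "shatters_size ((+) :: 'a poly \<Rightarrow> _) mult_powers \<phi> m n k" ..
  then obtain a b where a0: "\<forall>i<k. length (a i :: 'a poly list) = m"
    and ab0: "\<forall>i<k. \<forall>I\<subseteq>{..<k}. sat (+) mult_powers ((!) (a i @ b I)) \<phi> \<longleftrightarrow> i \<in> I"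
    unfolding shatters_size_def by (elim exE conjE)
  have a: "length (a i) = m" if "i < k" for i using a0 that by simp
  have ab: "sat (+) mult_powers ((!) (a i @ b I)) \<phi> \<longleftrightarrow> i \<in> I" if "i < k" "I \<subseteq> {..<k}" for i I
    using ab0 that by simp
  \<comment> \<open>\<open>H i\<close> collects all combinations of one \<open>a i\<close>. Its size
    bound \<open>card (L m)\<close> does not depend on \<open>k\<close> and serves as
    \<open>r\<close> in the colouring, while the bound on \<open>W\<close> is linear in
    \<open>k\<close>.\<close>
  define H where "H i = (\<lambda>c. lc {..<m} c ((!) (a i))) ` L m" for i
  have fH: "finite (H i)" and cH: "card (H i) \<le> card (L m)" for i
    using fL card_image_le by (auto simp: H_def)
  define W where "W = (\<Union>i<k. H i)"
  have fW: "finite W" using fH by (simp add: W_def)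
  have cW: "card W \<le> k * card (L m)"
    using card_UN_le_mult[of "{..<k}" H "card (L m)"] cH by (simp add: W_def)
  obtain S and col :: "'a poly list \<Rightarrow> (nat \<Rightarrow> 'a, 'a) colour"
    where S: "finite S" "card S \<le> colour_bound CARD('a) N C d (card (L m)) (card (L n)) (card W)" "\<And>y. col y \<in> S"
    and col: "\<And>y y' H. col y = col y' \<Longrightarrow> H \<subseteq> W \<Longrightarrow> card H \<le> card (L m) \<Longrightarrow>
      \<exists>U. pres C d U \<and> (\<forall>h\<in>H. \<forall>\<mu>\<in>L n. wt (h + lc {..<n} \<mu> ((!) y)) \<le> N \<or> wt (h + lc {..<n} \<mu> ((!) y')) \<le> N \<longrightarrow>
        (h + lc {..<n} \<mu> ((!) y), h + lc {..<n} \<mu> ((!) y')) \<in> transl U)"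
    by (rule approximation_colouring[OF fW fL[of n] fin d, of N C "card (L m)" "\<lambda>\<mu> y. lc {..<n} \<mu> ((!) y)"]) blast
  have equiv: "bf_equiv N C d {..<m + n} ((!) (a i @ y)) ((!) (a i @ y'))" if i: "i < k" and eq: "col y = col y'" for i y y'
  proof -
    have "H i \<subseteq> W" using i by (auto simp: W_def)
    from col[OF eq this cH] obtain U where U: "pres C d U" and
      tr: "\<And>h \<mu>. h \<in> H i \<Longrightarrow> \<mu> \<in> L n \<Longrightarrow> wt (h + lc {..<n} \<mu> ((!) y)) \<le> N \<or> wt (h + lc {..<n} \<mu> ((!) y')) \<le> N \<Longrightarrow>
        (h + lc {..<n} \<mu> ((!) y), h + lc {..<n} \<mu> ((!) y')) \<in> transl U" by blast
    show ?thesis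
      unfolding bf_equiv_def
    proof (intro exI conjI allI impI, rule U)
      fix c
      have "lc {..<m} (restrict c {..<m}) ((!) (a i)) \<in> H i" by (auto simp: H_def L_def)
      moreover have "restrict (\<lambda>j. c (m + j)) {..<n} \<in> L n" by (simp add: L_def)
      moreover assume "wt (lc {..<m + n} c ((!) (a i @ y))) \<le> N \<or> wt (lc {..<m + n} c ((!) (a i @ y'))) \<le> N"
      ultimately show "(lc {..<m + n} c ((!) (a i @ y)), lc {..<m + n} c ((!) (a i @ y'))) \<in> transl U"
        unfolding lc_append[OF a[OF i]] by (rule tr)
    qed
  qed
  have "colour_bound CARD('a) N C d (card (L m)) (card (L n)) (card W)
    \<le> colour_bound CARD('a) N C d (card (L m)) (card (L n)) (k * card (L m))"
    unfolding colour_bound_def pres_bound_def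
    by (intro mult_le_mono power_mono add_mono cW order_refl) auto
  then have "card S < card (Pow {..<k})" using S(2) k by (simp add: card_Pow)
  moreover have "card ((col \<circ> b) ` Pow {..<k}) \<le> card S"
    using S(1,3) by (intro card_mono) auto
  ultimately have "\<not> inj_on (col \<circ> b) (Pow {..<k})"
    by (intro pigeonhole) simp
  then obtain I I' where I: "I \<subseteq> {..<k}" "I' \<subseteq> {..<k}" "I \<noteq> I'" "col (b I) = col (b I')"
    by (auto simp: inj_on_def)
  then have "i \<in> I \<longleftrightarrow> i \<in> I'" if "i < k" for i
    using ab[OF that I(1)] ab[OF that I(2)] sat[OF equiv[OF that I(4)]] by simp
  then show False using I by blast
qed

theorem theorem7p8:
  fixes p :: nat
  assumes "prime p" and "p \<ge> 7" and "CARD('a::field) = p"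
  shows "NIP ((+) :: 'a poly \<Rightarrow> 'a poly \<Rightarrow> 'a poly) mult_powers"
proof -
  \<comment> \<open>An infinite type has \<open>CARD\<close> equal to 0, so positivity yields
    finiteness.\<close>
  have "CARD('a) > 0" using assms by simp
  then show ?thesis by (intro NIP_mult_powers) (simp add: card_gt_0_iff)
qed

end
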